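(* Let $p\ge2$ and assume (A.1), (A.2) and (A3). For $\lambda>0$ let $u_\lambda$ be the mild solution of $$\partial_t u(t,x)=\tfrac12\Delta u(t,x)+\lambda\sigma(u(t,x))\dot w(t,x),\quad t>0,\ x\in(0,1),\qquad u(0,x)=u_0(x),$$ with homogeneous Dirichlet boundary condition $u(t,0)=u(t,1)=0$, and set $\mathcal E_p(t,\lambda)=\big(\mathbb E[\|u_\lambda(t)\|_{L^p}^p]\big)^{1/p}$. Let $0<\lambda_L<\lambda_U$ be constants such that: (i) for all $\lambda\in(0,\lambda_L)$ and $x\in[\gamma,1-\gamma]$, $$-\infty<\limsup_{t\to\infty}\frac1t\log\mathbb E[|u_\lambda(t,x)|^p]\le\limsup_{t\to\infty}\frac1t\log\mathbb E[\|u_\lambda(t)\|_{L^\infty}^p]<0;$$ (ii) for all $\lambda\in(\lambda_U,\infty)$ and $x\in[\gamma,1-\gamma]$, $$0<\liminf_{t\to\infty}\frac1t\log\mathbb E[|u_\lambda(t,x)|^p]\le\limsup_{t\to\infty}\frac1t\log\mathbb E[\|u_\lambda(t)\|_{L^\infty}^p]<\infty.$$ Then for $0<\lambda<\lambda_L$, $$-\infty<\limsup_{t\to\infty}\frac1t\log\mathcal E_p(t,\lambda)<0,$$ and for $\lambda>\lambda_U$, $$0<\liminf_{t\to\infty}\frac1t\log\mathcal E_p(t,\lambda)<\infty .$$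
   Context: $\dot w(t,x)$ is a Gaussian space-time white noise on $[0,\infty)\times[0,1]$ and $\{\mathcal F_t\}_{t\ge0}$ is the filtration it generates (in the sense of Walsh). Assumptions, with $\gamma\in(0,1/4)$ a fixed number: (A.1) $u_0$ is non-random and continuous on $[0,1]$, and the Lebesgue measure of $\mathrm{supp}(u_0)\cap[\gamma,1-\gamma]$ is strictly positive. (A.2) $\sigma:\mathbb R\to\mathbb R$ is non-random, $\sigma(0)=0$, and there is $K_U>0$ with $|\sigma(u)-\sigma(v)|\le K_U|u-v|$ for all $u,v\in\mathbb R$. (A3) There is a constant $K_L>0$ with $K_L|u|\le|\sigma(u)|$ for all $u\in\mathbb R$. $g_D(t,x,y)$ denotes the fundamental solution (heat kernel) of $\partial_t=\frac12\Delta$ on $[0,1]$ with Dirichlet boundary condition at $0$ and $1$. A mild solution is an $\mathcal F_t$-adapted random field $u(t,x)$, $t\ge0$, $x\in[0,1]$, continuous in $(t,x)$, satisfying with probability one $$u(t,x)=\int_0^1 g_D(t,x,y)u_0(y)\,dy+\int_0^t\int_0^1 g_D(t-s,x,y)\,\lambda\sigma(u(s,y))\,w(ds\,dy),$$ the last integral being a Walsh stochastic integral. $\|u_\lambda(t)\|_{L^p}$ and $\|u_\lambda(t)\|_{L^\infty}$ are the $L^p([0,1])$- and $L^\infty([0,1])$-norms of $x\mapsto u_\lambda(t,x)$. The existence of such constants $\lambda_L,\lambda_U$ is the content of separate theorems of the paper. *)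

theory Defs
  imports "HOL-Probability.Probability"
begin

section \<open>Extended-valued logarithm, powers and norms\<close>

text \<open>Moments are taken in \<open>[0, \<infinity>]\<close> and their logarithms in \<open>[-\<infinity>, \<infinity>]\<close>, so that a divergent
  moment is \<open>\<infinity>\<close> (with a Bochner integral it would silently be \<open>0\<close>).\<close>

definition elog :: "ennreal \<Rightarrow> ereal" where
  "elog x = (if x = 0 then -\<infinity> else if x = \<top> then \<infinity> else ereal (ln (enn2real x)))"

text \<open>Only used with exponents \<open>a > 0\<close>.\<close>

definition epow :: "ennreal \<Rightarrow> real \<Rightarrow> ennreal" where
  "epow x a = (if x = \<top> then \<top> else ennreal (enn2real x powr a))"

definition Lp_norm :: "real \<Rightarrow> (real \<Rightarrow> real) \<Rightarrow> ennreal" where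
  "Lp_norm p f = epow (\<integral>\<^sup>+ x \<in> {0..1}. ennreal (\<bar>f x\<bar> powr p) \<partial>lborel) (1 / p)"

definition Linfty_norm :: "(real \<Rightarrow> real) \<Rightarrow> ennreal" where
  "Linfty_norm f = esssup (restrict_space lborel {0..1}) (\<lambda>x. ennreal \<bar>f x\<bar>)"

text \<open>Exponential growth rates of \<open>f\<close> along continuous time \<open>t \<rightarrow> \<infinity>\<close>.\<close>

definition limsup_rate :: "(real \<Rightarrow> ennreal) \<Rightarrow> ereal" where
  "limsup_rate f = Limsup at_top (\<lambda>t::real. ereal (1 / t) * elog (f t))"

definition liminf_rate :: "(real \<Rightarrow> ennreal) \<Rightarrow> ereal" where
  "liminf_rate f = Liminf at_top (\<lambda>t::real. ereal (1 / t) * elog (f t))"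

section \<open>Space-time white noise and its filtration\<close>

definition noise_domain :: "(real \<times> real) set set" where
  "noise_domain = {A \<in> sets borel. A \<subseteq> {0..} \<times> {0..1} \<and> emeasure lborel A < \<infinity>}"

text \<open>Walsh's definition: a Gaussian random set function with intensity Lebesgue measure that is
  additive, and independent over disjoint sets. The degenerate law \<open>N(0, 0)\<close> has no
  density and is treated separately.\<close>

definition white_noise :: "'w measure \<Rightarrow> ((real \<times> real) set \<Rightarrow> 'w \<Rightarrow> real) \<Rightarrow> bool" where
  "white_noise M W \<longleftrightarrow>
     (\<forall>A\<in>noise_domain. W A \<in> borel_measurable M) \<and>
     (\<forall>A\<in>noise_domain. measure lborel A = 0 \<longrightarrow> (AE \<omega> in M. W A \<omega> = 0)) \<and>
     (\<forall>A\<in>noise_domain. measure lborel A > 0 \<longrightarrow>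
        distributed M lborel (W A) (\<lambda>x. ennreal (normal_density 0 (sqrt (measure lborel A)) x))) \<and>
     (\<forall>A\<in>noise_domain. \<forall>B\<in>noise_domain. A \<inter> B = {} \<longrightarrow>
        (AE \<omega> in M. W (A \<union> B) \<omega> = W A \<omega> + W B \<omega>)) \<and>
     (\<forall>(A :: nat \<Rightarrow> (real \<times> real) set) n. (\<forall>i<n. A i \<in> noise_domain) \<and> disjoint_family_on A {..<n} \<longrightarrow>
        prob_space.indep_vars M (\<lambda>_. borel) (\<lambda>i. W (A i)) {..<n})"

definition noise_algebra ::
  "'w measure \<Rightarrow> ((real \<times> real) set \<Rightarrow> 'w \<Rightarrow> real) \<Rightarrow> real \<Rightarrow> 'w set set" where
  "noise_algebra M W t = sigma_sets (space M)
     ({W ({0..s} \<times> A) -` B \<inter> space M | s A B.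
         0 \<le> s \<and> s \<le> t \<and> A \<in> sets borel \<and> A \<subseteq> {0..1} \<and> B \<in> sets borel} \<union> null_sets M)"

text \<open>The usual (right-continuous, null-set augmented) filtration of the noise.\<close>

definition noise_filtration ::
  "'w measure \<Rightarrow> ((real \<times> real) set \<Rightarrow> 'w \<Rightarrow> real) \<Rightarrow> real \<Rightarrow> 'w measure" where
  "noise_filtration M W t = sigma (space M) (\<Inter>r\<in>{t<..}. noise_algebra M W r)"

section \<open>Walsh integral\<close>

text \<open>The list entry \<open>(X, a, b, A)\<close> stands for the elementary integrand
  \<open>X(\<omega>) 1\<^bsub>(a,b]\<^esub>(s) 1\<^bsub>A\<^esub>(y)\<close>, with \<open>X\<close> bounded and measurable with respect to the
  \<open>\<sigma>\<close>-algebra at time \<open>a\<close>; a list stands for the sum of its entries.\<close>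

type_synonym 'w simple_integrand = "(('w \<Rightarrow> real) \<times> real \<times> real \<times> real set) list"

definition simple_integrand ::
  "'w measure \<Rightarrow> ((real \<times> real) set \<Rightarrow> 'w \<Rightarrow> real) \<Rightarrow> 'w simple_integrand \<Rightarrow> bool" where
  "simple_integrand M W \<phi> \<longleftrightarrow>
     (\<forall>(X, a, b, A) \<in> set \<phi>.
        0 \<le> a \<and> a \<le> b \<and> A \<in> sets borel \<and> A \<subseteq> {0..1} \<and>
        X \<in> borel_measurable (noise_filtration M W a) \<and> (\<exists>c. \<forall>\<omega>\<in>space M. \<bar>X \<omega>\<bar> \<le> c))"

definition simple_value :: "'w simple_integrand \<Rightarrow> 'w \<Rightarrow> real \<Rightarrow> real \<Rightarrow> real" where
  "simple_value \<phi> \<omega> s y =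
     (\<Sum>(X, a, b, A) \<leftarrow> \<phi>. X \<omega> * indicator {a<..b} s * indicator A y)"

definition simple_integral ::
  "((real \<times> real) set \<Rightarrow> 'w \<Rightarrow> real) \<Rightarrow> 'w simple_integrand \<Rightarrow> 'w \<Rightarrow> real" where
  "simple_integral W \<phi> \<omega> = (\<Sum>(X, a, b, A) \<leftarrow> \<phi>. X \<omega> * W ({a<..b} \<times> A) \<omega>)"

text \<open>The integral of \<open>f\<close> over \<open>[0, \<infinity>) \<times> [0, 1]\<close> exists and is (a version of) \<open>I\<close>: both are limits
  in \<open>L\<^sup>2\<close> of simple integrands and of their integrals. The integrands so obtained are
  Walsh's: the predictable ones with \<open>E \<integral>\<integral> f\<^sup>2 < \<infinity>\<close>, up to null sets.
  The completion absorbs modifications of \<open>f\<close> on a null set.\<close>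

definition has_walsh_integral ::
  "'w measure \<Rightarrow> ((real \<times> real) set \<Rightarrow> 'w \<Rightarrow> real) \<Rightarrow> ('w \<Rightarrow> real \<Rightarrow> real \<Rightarrow> real) \<Rightarrow> ('w \<Rightarrow> real) \<Rightarrow> bool"
  where
  "has_walsh_integral M W f I \<longleftrightarrow>
     (\<lambda>(\<omega>, s, y). f \<omega> s y) \<in> borel_measurable (completion (M \<Otimes>\<^sub>M lborel)) \<and>
     I \<in> borel_measurable M \<and>
     (\<exists>\<phi>. (\<forall>n::nat. simple_integrand M W (\<phi> n)) \<and>
        (\<lambda>n. \<integral>\<^sup>+ (\<omega>, s, y). ennreal ((simple_value (\<phi> n) \<omega> s y - f \<omega> s y)\<^sup>2) \<partial>(M \<Otimes>\<^sub>M lborel))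
          \<longlonglongrightarrow> 0 \<and>
        (\<lambda>n. \<integral>\<^sup>+ \<omega>. ennreal ((simple_integral W (\<phi> n) \<omega> - I \<omega>)\<^sup>2) \<partial>M) \<longlonglongrightarrow> 0)"

section \<open>The stochastic heat equation\<close>

text \<open>Fundamental solution of \<open>\<partial>\<^sub>t = 1/2 \<Delta>\<close> on \<open>[0, 1]\<close> with Dirichlet conditions, for \<open>t > 0\<close>,
  in the orthonormal eigenbasis \<open>\<surd>2 sin(n \<pi> x)\<close>, \<open>n \<ge> 1\<close>, of eigenvalues \<open>-n\<^sup>2 \<pi>\<^sup>2 / 2\<close>.\<close>

definition dirichlet_heat_kernel :: "real \<Rightarrow> real \<Rightarrow> real \<Rightarrow> real" where
  "dirichlet_heat_kernel t x y =
     2 * (\<Sum>k. let n = real (Suc k) in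
            exp (- (n\<^sup>2 * pi\<^sup>2 * t / 2)) * sin (n * pi * x) * sin (n * pi * y))"

text \<open>\<open>u t x \<omega>\<close> is a mild solution. For \<open>t = 0\<close> the kernel is a point mass and the equation
  reads \<open>u(0, x) = u\<^sub>0(x)\<close>. Continuity is not demanded at the two corners \<open>(0, 0)\<close> and \<open>(0, 1)\<close>:
  since \<open>u(t, 0) = u(t, 1) = 0\<close> for \<open>t > 0\<close>, it would force \<open>u\<^sub>0(0) = u\<^sub>0(1) = 0\<close>.\<close>

definition mild_solution ::
  "'w measure \<Rightarrow> ((real \<times> real) set \<Rightarrow> 'w \<Rightarrow> real) \<Rightarrow> (real \<Rightarrow> real) \<Rightarrow> (real \<Rightarrow> real) \<Rightarrow> real
     \<Rightarrow> (real \<Rightarrow> real \<Rightarrow> 'w \<Rightarrow> real) \<Rightarrow> bool" where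
  "mild_solution M W u0 \<sigma> lam u \<longleftrightarrow>
     (\<forall>t\<ge>0. \<forall>x\<in>{0..1}. u t x \<in> borel_measurable (noise_filtration M W t)) \<and>
     (AE \<omega> in M. continuous_on ({0..} \<times> {0..1} - {(0, 0), (0, 1)}) (\<lambda>(t, x). u t x \<omega>)) \<and>
     (\<forall>x\<in>{0..1}. AE \<omega> in M. u 0 x \<omega> = u0 x) \<and>
     (\<forall>t>0. \<forall>x\<in>{0..1}. \<exists>I.
        has_walsh_integral M W
          (\<lambda>\<omega> s y. indicator ({0..<t} \<times> {0..1}) (s, y) *
                    (dirichlet_heat_kernel (t - s) x y * (lam * \<sigma> (u s y \<omega>)))) I \<and>
        (AE \<omega> in M. u t x \<omega> =
           (LINT y:{0..1}|lborel. dirichlet_heat_kernel t x y * u0 y) + I \<omega>))"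

definition supp :: "(real \<Rightarrow> real) \<Rightarrow> real set" where
  "supp f = closure {x \<in> {0..1}. f x \<noteq> 0}"

section \<open>Moments\<close>

definition moment_at :: "'w measure \<Rightarrow> (real \<Rightarrow> real \<Rightarrow> 'w \<Rightarrow> real) \<Rightarrow> real \<Rightarrow> real \<Rightarrow> real \<Rightarrow> ennreal" where
  "moment_at M u p x t = (\<integral>\<^sup>+ \<omega>. ennreal (\<bar>u t x \<omega>\<bar> powr p) \<partial>M)"

definition moment_sup :: "'w measure \<Rightarrow> (real \<Rightarrow> real \<Rightarrow> 'w \<Rightarrow> real) \<Rightarrow> real \<Rightarrow> real \<Rightarrow> ennreal" where
  "moment_sup M u p t = (\<integral>\<^sup>+ \<omega>. epow (Linfty_norm (\<lambda>x. u t x \<omega>)) p \<partial>M)"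

definition energy :: "'w measure \<Rightarrow> (real \<Rightarrow> real \<Rightarrow> 'w \<Rightarrow> real) \<Rightarrow> real \<Rightarrow> real \<Rightarrow> ennreal" where
  "energy M u p t = epow (\<integral>\<^sup>+ \<omega>. epow (Lp_norm p (\<lambda>x. u t x \<omega>)) p \<partial>M) (1 / p)"

end

theory Submission
  imports Defs "HOL-Real_Asymp.Real_Asymp"
begin

text \<open>By Fubini, \<open>\<E>\<^sub>p(t)\<^sup>p\<close> is the integral over \<open>x\<close> of the moments \<open>E |u(t, x)|\<^sup>p\<close>, which gives the
  upper bounds from the moments of the supremum. For large \<open>lam\<close>, the moments grow
  at a common rate from a common time on for all \<open>x\<close> in a set of positive measure, at least along a
  sequence of times that would realise a nonpositive lower rate of the energy.

  For small \<open>lam\<close>, the pointwise lower bound on the moments does not suffice, since the times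
  that realise an upper rate may depend on \<open>x\<close>. Instead, the Walsh integral has mean zero, so the mean
  of \<open>u(t, x)\<close> is the heat flow of \<open>u\<^sub>0\<close>. As \<open>u\<^sub>0\<close> does not vanish identically, it has a nonzero sine
  coefficient \<open>c\<^sub>n\<close>, and the energy is at least of the order of \<open>|c\<^sub>n| exp (- n\<^sup>2 \<pi>\<^sup>2 t / 2)\<close>.\<close>

section \<open>Logarithms, powers and growth rates\<close>

text \<open>Moments are measurable in \<open>x\<close> only at a fixed time, so a set of all
  \<open>x\<close> obeying a bound for every real t \<ge> T is an uncountable intersection that need
  not be measurable. Arguing by contradiction leaves only countably many times. For small
  \<open>lam\<close> the mean controls just a first moment; the inequality a \<le> c + c^(1-p) a^p,
  with \<open>c\<close> tuned to the heat flow, carries this to exponent \<open>p\<close>. That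
  stochastic integrals have mean zero rests on the independence of future noise from the past. White
  noise supplies independence only for finite disjoint families, and additivity only up to null
  sets, whereas the filtration is augmented and right-continuous; this forces the detour through
  atoms, almost sure representations and a small time shift. Joint measurability of the solution in
  position and sample is likewise not given, and is recovered from the continuity of paths before
  Fubini is applied.\<close>

lemma epow_mono: "0 \<le> a \<Longrightarrow> x \<le> y \<Longrightarrow> epow x a \<le> epow y a"
  by (auto simp: epow_def top_unique intro!: ennreal_leI powr_mono2 enn2real_mono simp: less_top)

lemma epow_epow_inverse: "0 < a \<Longrightarrow> epow (epow x (1 / a)) a = x"
  by (auto simp: epow_def powr_powr less_top)

lemma epow_inverse_epow: "0 < a \<Longrightarrow> epow (epow x a) (1 / a) = x"
  by (auto simp: epow_def powr_powr less_top)

lemma epow_ennreal: "0 \<le> x \<Longrightarrow> epow (ennreal x) a = ennreal (x powr a)"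
  by (simp add: epow_def)

lemma elog_mono: "x \<le> y \<Longrightarrow> elog x \<le> elog y"
  by (auto simp: elog_def top_unique less_top intro!: enn2real_mono ln_mono simp: enn2real_positive_iff zero_less_iff_neq_zero)

lemma elog_ennreal: "0 < x \<Longrightarrow> elog (ennreal x) = ereal (ln x)"
  by (simp add: elog_def)

lemma elog_epow:
  assumes "0 < a"
  shows "elog (epow x a) = ereal a * elog x"
proof (cases x rule: ennreal_cases)
  case (real r)
  then show ?thesis using assms by (cases "r = 0") (auto simp: epow_def elog_ennreal ln_powr elog_def)
next
  case top
  then show ?thesis using assms by (simp add: epow_def elog_def)
qed

lemma limsup_rate_epow:
  assumes "0 < a"
  shows "limsup_rate (\<lambda>t. epow (f t) a) = ereal a * limsup_rate f"
proof -
  have "limsup_rate (\<lambda>t. epow (f t) a) = Limsup at_top (\<lambda>t. ereal a * (ereal (1 / t) * elog (f t)))"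
    unfolding limsup_rate_def using assms by (simp add: elog_epow mult.left_commute)
  then show ?thesis
    unfolding limsup_rate_def using assms by (simp add: Limsup_ereal_mult_left)
qed

lemma limsup_rate_mono:
  assumes "\<And>t. 0 < t \<Longrightarrow> f t \<le> g t"
  shows "limsup_rate f \<le> limsup_rate g"
  unfolding limsup_rate_def
  by (rule Limsup_mono)
     (auto intro!: eventually_mono[OF eventually_gt_at_top[of 0]] ereal_mult_left_mono elog_mono assms)

lemma liminf_rate_le_limsup_rate: "liminf_rate f \<le> limsup_rate f"
  unfolding liminf_rate_def limsup_rate_def by (rule Liminf_le_Limsup) simp

text \<open>The prefactor enters the rate only through \<open>ln c / t\<close>, which vanishes, so
  such a lower bound excludes the rate -\<infinity>.\<close>

lemma limsup_rate_ge_exponential: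
  assumes "0 < c" "\<And>t. 0 < t \<Longrightarrow> ennreal (c * exp (- (k * t))) \<le> f t"
  shows "ereal (- k) \<le> limsup_rate f"
proof -
  have "((\<lambda>t. ln c * inverse t - k) \<longlongrightarrow> ln c * 0 - k) at_top"
    by (intro tendsto_intros tendsto_inverse_0_at_top filterlim_ident)
  then have "((\<lambda>t. ereal (ln c * inverse t - k)) \<longlongrightarrow> ereal (- k)) at_top"
    by simp
  then have "ereal (- k) = Limsup at_top (\<lambda>t. ereal (ln c * inverse t - k))"
    by (intro lim_imp_Limsup[symmetric]) auto
  also have "\<dots> \<le> limsup_rate f"
    unfolding limsup_rate_def
  proof (rule Limsup_mono, rule eventually_mono[OF eventually_gt_at_top[of 0]])
    fix t :: real assume t: "0 < t"
    have "ereal (ln c * inverse t - k) = ereal (1 / t) * elog (ennreal (c * exp (- (k * t))))"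
      using t assms(1) by (simp add: elog_ennreal ln_mult field_simps)
    also have "\<dots> \<le> ereal (1 / t) * elog (f t)"
      using t by (intro ereal_mult_left_mono elog_mono assms) auto
    finally show "ereal (ln c * inverse t - k) \<le> ereal (1 / t) * elog (f t)" .
  qed
  finally show ?thesis .
qed

text \<open>Turns a comparison of rates into one of values. At \<open>x = 0\<close> both sides are
  false, because \<open>elog 0\<close> is -\<infinity> and the exponential is positive; at infinity
  both are true.\<close>

lemma elog_le_iff:
  assumes "0 < t"
  shows "ereal r \<le> ereal (1 / t) * elog x \<longleftrightarrow> ennreal (exp (r * t)) \<le> x"
proof (cases x rule: ennreal_cases)
  case (real y)
  have "r \<le> ln y / t \<longleftrightarrow> exp (r * t) \<le> y" if "0 < y"
    using that assms by (simp add: pos_le_divide_eq ln_ge_iff)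
  moreover have "\<not> exp (r * t) \<le> 0" by (simp add: not_le)
  ultimately show ?thesis using real assms
    by (cases "y = 0") (auto simp: elog_ennreal elog_def)
next
  case top
  then show ?thesis using assms by (simp add: elog_def)
qed

text \<open>The rate may be \<infinity>, so a real \<open>r\<close> strictly below it is chosen
  first; the slack also turns the Liminf into an eventual inequality.\<close>

lemma liminf_rate_pos_iff:
  "0 < liminf_rate f \<longleftrightarrow> (\<exists>r>0. eventually (\<lambda>t. ennreal (exp (r * t)) \<le> f t) at_top)"
proof
  assume "0 < liminf_rate f"
  then obtain r where r: "0 < ereal r" "ereal r < liminf_rate f" using ereal_dense2 by blast
  have "eventually (\<lambda>t. ereal r < ereal (1 / t) * elog (f t)) at_top"
    using r(2) unfolding liminf_rate_def by (rule less_LiminfD)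
  then have "eventually (\<lambda>t. ennreal (exp (r * t)) \<le> f t) at_top"
    using eventually_gt_at_top[of 0] by eventually_elim (auto simp: elog_le_iff[symmetric])
  then show "\<exists>r>0. eventually (\<lambda>t. ennreal (exp (r * t)) \<le> f t) at_top" using r by auto
next
  assume "\<exists>r>0. eventually (\<lambda>t. ennreal (exp (r * t)) \<le> f t) at_top"
  then obtain r where r: "r > 0" "eventually (\<lambda>t. ennreal (exp (r * t)) \<le> f t) at_top" by blast
  have "eventually (\<lambda>t. ereal r \<le> ereal (1 / t) * elog (f t)) at_top"
    using r(2) eventually_gt_at_top[of 0] by eventually_elim (simp add: elog_le_iff)
  then have "ereal r \<le> liminf_rate f" unfolding liminf_rate_def by (rule Liminf_bounded)
  then show "0 < liminf_rate f" using r(1) by (auto intro: less_le_trans[of _ "ereal r"])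
qed

text \<open>Rates and starting times depend on \<open>x\<close>, but countably many sets with a
  common rate and a common start cover the space. One of them is not null and already makes the
  integral too large.\<close>

lemma liminf_rate_integral_pos:
  assumes "finite_measure N" "emeasure N (space N) \<noteq> 0"
    and meas: "\<And>t. 0 < t \<Longrightarrow> f t \<in> borel_measurable N"
    and pos: "\<And>x. x \<in> space N \<Longrightarrow> 0 < liminf_rate (\<lambda>t. f t x)"
  shows "0 < liminf_rate (\<lambda>t. \<integral>\<^sup>+ x. f t x \<partial>N)"
proof (rule ccontr)
  interpret finite_measure N by fact
  let ?F = "\<lambda>t. \<integral>\<^sup>+ x. f t x \<partial>N"
  assume "\<not> 0 < liminf_rate ?F"
  \<comment> \<open>Negating the bound with rate \<open>1 / Suc n\<close> from time
    \<open>Suc n\<close> on yields times tending to infinity, while the violated rates tend to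
    0.\<close>
  then have "\<exists>t. real (Suc n) \<le> t \<and> ?F t < ennreal (exp (1 / real (Suc n) * t))" for n
    unfolding liminf_rate_pos_iff eventually_at_top_linorder
    by (metis not_le zero_less_divide_1_iff of_nat_0_less_iff zero_less_Suc)
  then obtain \<tau> where \<tau>: "\<And>n. real (Suc n) \<le> \<tau> n"
    and less: "\<And>n. ?F (\<tau> n) < ennreal (exp (1 / real (Suc n) * \<tau> n))" by metis
  have \<tau>pos: "0 < \<tau> n" for n using \<tau>[of n] by simp
  \<comment> \<open>The rate is \<open>2 / Suc n\<close> so that half of the exponent can later
    absorb the measure of \<open>G n\<close>. Only the times \<open>\<tau> k\<close> enter, hence
    the intersection is countable.\<close>
  define G where "G = (\<lambda>n. {x\<in>space N. \<forall>k\<ge>n. ennreal (exp (2 / real (Suc n) * \<tau> k)) \<le> f (\<tau> k) x})"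
  have G[measurable]: "G n \<in> sets N" for n
    unfolding G_def using meas[OF \<tau>pos] by measurable
  have "space N \<subseteq> (\<Union>n. G n)"
  proof
    fix x assume x: "x \<in> space N"
    obtain r T where r: "r > 0" and T: "\<And>t. T \<le> t \<Longrightarrow> ennreal (exp (r * t)) \<le> f t x"
      using pos[OF x] unfolding liminf_rate_pos_iff eventually_at_top_linorder by blast
    obtain n where n: "max T (2 / r) < real (Suc n)" using reals_Archimedean2 less_trans
      by (metis lessI of_nat_less_iff)
    have "x \<in> G n"
      unfolding G_def
    proof (intro CollectI conjI x allI impI)
      fix k assume k: "n \<le> k"
      have "T \<le> \<tau> k" using n k \<tau>[of k] by simp
      moreover have "2 / real (Suc n) \<le> r" using n r by (simp add: field_simps)
      then have "2 / real (Suc n) * \<tau> k \<le> r * \<tau> k"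
        using \<tau>pos[of k] by (intro mult_right_mono) auto
      then have "exp (2 / real (Suc n) * \<tau> k) \<le> exp (r * \<tau> k)" by simp
      ultimately show "ennreal (exp (2 / real (Suc n) * \<tau> k)) \<le> f (\<tau> k) x"
        using T ennreal_leI order_trans by blast
    qed
    then show "x \<in> (\<Union>n. G n)" by blast
  qed
  then have "(\<Union>n. G n) = space N" unfolding G_def by blast
  then have "\<exists>n. emeasure N (G n) \<noteq> 0"
    using emeasure_UN_eq_0[of N G] assms(2) G by (metis image_subsetI)
  then obtain n where n: "0 < measure N (G n)"
    by (auto simp: emeasure_eq_measure zero_less_measure_iff)
  \<comment> \<open>As \<open>\<tau> k\<close> is at least \<open>Suc k\<close>, one of the two
    factors \<open>exp (\<tau> k / Suc n)\<close> outgrows the fixed measure of \<open>G n\<close>;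
    the other one is left to contradict the choice of \<open>\<tau> k\<close>.\<close>
  have "eventually (\<lambda>k. measure N (G n) * exp (real (Suc k) / real (Suc n)) > 1) sequentially"
  proof -
    have "filterlim (\<lambda>k. exp (real (Suc k) / real (Suc n))) at_top sequentially" by real_asymp
    then have "filterlim (\<lambda>k. measure N (G n) * exp (real (Suc k) / real (Suc n))) at_top sequentially"
      by (rule filterlim_tendsto_pos_mult_at_top[OF tendsto_const n])
    then show ?thesis by (simp add: filterlim_at_top_dense)
  qed
  then obtain k where k: "n \<le> k" "measure N (G n) * exp (real (Suc k) / real (Suc n)) > 1"
    by (metis (mono_tags, lifting) eventually_sequentially linorder_linear)
  let ?a = "\<tau> k / real (Suc n)"
  have "ennreal (exp ?a) \<le> ennreal (exp ?a * (measure N (G n) * exp ?a))"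
  proof (intro ennreal_leI)
    have "exp (real (Suc k) / real (Suc n)) \<le> exp ?a" using \<tau>[of k] by (simp add: divide_right_mono del: of_nat_Suc)
    then have "1 \<le> measure N (G n) * exp ?a" using k(2) n mult_left_mono[of _ "exp ?a" "measure N (G n)"]
      by (smt (verit))
    then show "exp ?a \<le> exp ?a * (measure N (G n) * exp ?a)" by simp
  qed
  also have "\<dots> = ennreal (exp (2 / real (Suc n) * \<tau> k)) * emeasure N (G n)"
  proof -
    have "exp (2 / real (Suc n) * \<tau> k) = exp ?a * exp ?a"
      by (simp add: exp_add[symmetric] del: of_nat_Suc)
    then show ?thesis by (simp add: emeasure_eq_measure ennreal_mult[symmetric] mult_ac)
  qed
  also have "\<dots> = (\<integral>\<^sup>+ x. ennreal (exp (2 / real (Suc n) * \<tau> k)) * indicator (G n) x \<partial>N)"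
    using G by (simp add: nn_integral_cmult_indicator)
  also have "\<dots> \<le> ?F (\<tau> k)"
    using k(1) by (intro nn_integral_mono) (auto simp: G_def split: split_indicator)
  also have "\<dots> < ennreal (exp (1 / real (Suc k) * \<tau> k))" by (rule less)
  also have "\<dots> \<le> ennreal (exp ?a)"
    using k(1) \<tau>pos[of k] by (intro ennreal_leI) (simp add: frac_le)
  finally show False by simp
qed

section \<open>Sine series\<close>

lemma sums_integral_continuous:
  fixes f :: "nat \<Rightarrow> real \<Rightarrow> real"
  assumes cont: "\<And>k. continuous_on {a..b} (f k)"
    and bound: "\<And>k x. x \<in> {a..b} \<Longrightarrow> \<bar>f k x\<bar> \<le> B k" and B: "summable B"
  shows "(\<lambda>k. integral {a..b} (f k)) sums integral {a..b} (\<lambda>x. \<Sum>k. f k x)"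
    and "continuous_on {a..b} (\<lambda>x. \<Sum>k. f k x)"
proof -
  have lim: "uniform_limit {a..b} (\<lambda>n x. \<Sum>k<n. f k x) (\<lambda>x. \<Sum>k. f k x) sequentially"
    using bound B by (intro Weierstrass_m_test) auto
  have c: "continuous_on {a..b} (\<lambda>x. \<Sum>k<n. f k x)" for n
    using cont by (intro continuous_intros) auto
  show "continuous_on {a..b} (\<lambda>x. \<Sum>k. f k x)"
    using c by (intro uniform_limit_theorem[OF _ lim]) auto
  obtain I J where I: "\<And>n. ((\<lambda>x. \<Sum>k<n. f k x) has_integral I n) {a..b}"
    and J: "((\<lambda>x. \<Sum>k. f k x) has_integral J) {a..b}" "I \<longlonglongrightarrow> J"
    using uniform_limit_integral[OF lim c] by auto
  have I_eq: "I = (\<lambda>n. \<Sum>k<n. integral {a..b} (f k))"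
  proof
    fix n
    show "I n = (\<Sum>k<n. integral {a..b} (f k))"
    unfolding integral_unique[OF I, symmetric]
    using cont by (intro integral_sum) (auto intro: integrable_continuous_interval)
  qed
  show "(\<lambda>k. integral {a..b} (f k)) sums integral {a..b} (\<lambda>x. \<Sum>k. f k x)"
    using J(2) unfolding integral_unique[OF J(1)] sums_def by (simp only: I_eq)
qed

section \<open>Orthogonality and completeness of the sines\<close>

lemma integral_cos_pi: "integral {0..1} (\<lambda>x. cos (real_of_int k * pi * x)) = (if k = 0 then 1 else 0)"
proof (cases "k = 0")
  case False
  let ?F = "\<lambda>x. sin (real_of_int k * pi * x) / (real_of_int k * pi)"
  have "((\<lambda>x. cos (real_of_int k * pi * x)) has_integral (?F 1 - ?F 0)) {0..1}"
    using False
    by (intro fundamental_theorem_of_calculus)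
       (auto intro!: derivative_eq_intros simp flip: has_real_derivative_iff_has_vector_derivative)
  moreover have "sin (real_of_int k * pi) = 0" by (metis sin_zero_iff_int2)
  ultimately show ?thesis using False by (simp add: integral_unique)
qed simp

text \<open>The product is a difference of cosines of frequencies \<open>n - m\<close> and
  \<open>n + m\<close>; the former may be negative, hence the integer frequencies in the cosine
  integral.\<close>

lemma integral_sin_sin:
  assumes "0 < n" "0 < m"
  shows "integral {0..1} (\<lambda>x. sin (real n * pi * x) * sin (real m * pi * x)) = (if n = m then 1 / 2 else 0)"
proof -
  have int: "(\<lambda>x. cos (real_of_int k * pi * x)) integrable_on {0..1}" for k
    by (intro integrable_continuous_interval continuous_intros)
  have "integral {0..1} (\<lambda>x. sin (real n * pi * x) * sin (real m * pi * x)) =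
      integral {0..1} (\<lambda>x. (1/2) * (cos (real_of_int (int n - int m) * pi * x) - cos (real_of_int (int n + int m) * pi * x)))"
    by (simp add: sin_times_sin left_diff_distrib distrib_right)
  also have "\<dots> = (1/2) * ((if int n - int m = 0 then 1 else 0) - (if int n + int m = 0 then 1 else 0))"
    by (subst integral_mult_right, subst integral_diff[OF int int], subst (1 2) integral_cos_pi) (rule refl)
  finally show ?thesis using assms by (cases "n = m") simp_all
qed

text \<open>Unnormalised: the squared sine has integral 1/2, so a sine series carries the
  coefficient \<open>2 * sine_coeff f n\<close>. The 2 matches the one in the heat kernel.\<close>

definition sine_coeff :: "(real \<Rightarrow> real) \<Rightarrow> nat \<Rightarrow> real" where
  "sine_coeff f n = integral {0..1} (\<lambda>y. f y * sin (real n * pi * y))"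

text \<open>Multiplying \<open>sin (n \<pi> y)\<close> by \<open>cos (\<pi> y)\<close> gives a combination of neighbouring sines. Hence a function
  with vanishing sine coefficients is orthogonal to \<open>sin (\<pi> y) q(cos (\<pi> y))\<close> for every polynomial \<open>q\<close>, and
  the polynomials in \<open>cos (\<pi> y)\<close> are dense by the Weierstrass theorem.\<close>

lemma sine_coeff_eq_0_imp_moments_eq_0:
  assumes f: "continuous_on {0..1} f" and z: "\<And>n. 0 < n \<Longrightarrow> sine_coeff f n = 0"
  shows "integral {0..1} (\<lambda>y. f y * sin (real n * pi * y) * cos (pi * y) ^ k) = 0"
proof (induction k arbitrary: n)
  case 0
  show ?case using z[of n] by (cases "n = 0") (auto simp: sine_coeff_def)
next
  case (Suc k)
  show ?case
  \<comment> \<open>For \<open>n = 0\<close> the sine vanishes. Including 0 in the claim lets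
    \<open>m = 0\<close> serve as the lower neighbour of \<open>n = 1\<close>.\<close>
  proof (cases n)
    case (Suc m)
    have int: "(\<lambda>y. f y * sin (real n * pi * y) * cos (pi * y) ^ k) integrable_on {0..1}" for n
      by (intro integrable_continuous_interval continuous_intros f)
    have eq: "(\<lambda>y. f y * sin (real n * pi * y) * cos (pi * y) ^ Suc k) =
      (\<lambda>y. (1/2) * (f y * sin (real (Suc n) * pi * y) * cos (pi * y) ^ k + f y * sin (real m * pi * y) * cos (pi * y) ^ k))"
    proof
      fix y
      have "sin (real n * pi * y) * cos (pi * y) = (sin (real (Suc n) * pi * y) + sin (real m * pi * y)) / 2"
      proof -
        have "real n * pi * y + pi * y = real (Suc n) * pi * y" "real n * pi * y - pi * y = real m * pi * y"
          by (simp_all add: Suc algebra_simps)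
        then show ?thesis by (simp only: sin_times_cos)
      qed
      then have "f y * cos (pi * y) ^ k * (sin (real n * pi * y) * cos (pi * y)) =
          f y * cos (pi * y) ^ k * ((sin (real (Suc n) * pi * y) + sin (real m * pi * y)) / 2)" by simp
      then show "f y * sin (real n * pi * y) * cos (pi * y) ^ Suc k =
        (1/2) * (f y * sin (real (Suc n) * pi * y) * cos (pi * y) ^ k + f y * sin (real m * pi * y) * cos (pi * y) ^ k)"
        by (simp only: power_Suc) (simp add: algebra_simps)
    qed
    have "integral {0..1} (\<lambda>y. (1/2) * (f y * sin (real (Suc n) * pi * y) * cos (pi * y) ^ k
        + f y * sin (real m * pi * y) * cos (pi * y) ^ k)) = 0"
      by (subst integral_mult_right, subst integral_add[OF int int], subst (1 2) Suc.IH) simp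
    then show ?thesis unfolding eq .
  qed simp
qed

text \<open>With polynomials approximating \<open>f\<close> itself, the integral of its square
  against the weight \<open>sin (pi * y)\<close> must be 0, and this weight is positive in the
  interior.\<close>

lemma sine_coeff_complete:
  assumes f: "continuous_on {0..1} f" and z: "\<And>n. 0 < n \<Longrightarrow> sine_coeff f n = 0" and x: "x \<in> {0..1}"
  shows "f x = 0"
proof -
  \<comment> \<open>The substitution \<open>s = cos (pi * y)\<close> maps [0, 1] bijectively onto
    [-1, 1] and makes \<open>f\<close> a continuous function of \<open>s\<close>.\<close>
  define \<phi> where "\<phi> = (\<lambda>s. f (arccos s / pi))"
  have \<phi>: "continuous_on {-1..1} \<phi>"
    unfolding \<phi>_def
    by (rule continuous_on_compose2[OF f]) (auto intro!: continuous_intros simp: arccos_lbound arccos_ubound)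
  have f\<phi>: "f y = \<phi> (cos (pi * y))" if "y \<in> {0..1}" for y
    using that by (simp add: \<phi>_def arccos_cos)
  let ?I = "integral {0..1} (\<lambda>y. f y * f y * sin (pi * y))"
  let ?K = "integral {0..1} (\<lambda>y. \<bar>f y\<bar>)"
  have sin_pos: "0 \<le> sin (pi * y)" if "y \<in> {0..1}" for y
    using that by (intro sin_ge_zero) (auto simp: mult_left_le)
  \<comment> \<open>One of the two factors \<open>f\<close> may be replaced by its approximation
    error, because \<open>f\<close> is orthogonal to the weighted polynomial.\<close>
  have bound: "?I \<le> \<epsilon> * ?K" if pos: "\<epsilon> > 0" for \<epsilon>
  proof -
    obtain g where g: "real_polynomial_function g" "\<And>s. s \<in> {-1..1} \<Longrightarrow> \<bar>\<phi> s - g s\<bar> < \<epsilon>"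
      using Stone_Weierstrass_real_polynomial_function[OF compact_Icc \<phi> pos] by blast
    obtain a n where g_eq: "g = (\<lambda>s. \<Sum>i\<le>n. a i * s ^ i)"
      using g(1) by (auto simp: real_polynomial_function_iff_sum)
    have "integral {0..1} (\<lambda>y. f y * sin (pi * y) * g (cos (pi * y))) =
        integral {0..1} (\<lambda>y. \<Sum>i\<le>n. a i * (f y * sin (real 1 * pi * y) * cos (pi * y) ^ i))"
      by (simp add: g_eq sum_distrib_left fun_eq_iff mult_ac)
    also have "\<dots> = (\<Sum>i\<le>n. integral {0..1} (\<lambda>y. a i * (f y * sin (real 1 * pi * y) * cos (pi * y) ^ i)))"
      by (intro integral_sum integrable_continuous_interval continuous_intros f) auto
    also have "\<dots> = 0"
      by (simp only: integral_mult_right sine_coeff_eq_0_imp_moments_eq_0[OF f z]) simp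
    finally have 0: "integral {0..1} (\<lambda>y. f y * sin (pi * y) * g (cos (pi * y))) = 0" .
    have gc: "continuous_on {0..1} (\<lambda>y. g (cos (pi * y)))"
      unfolding g_eq by (intro continuous_intros)
    have "?I = integral {0..1} (\<lambda>y. f y * f y * sin (pi * y)) - integral {0..1} (\<lambda>y. f y * sin (pi * y) * g (cos (pi * y)))"
      using 0 by simp
    also have "\<dots> = integral {0..1} (\<lambda>y. f y * f y * sin (pi * y) - f y * sin (pi * y) * g (cos (pi * y)))"
      by (intro integral_diff[symmetric] integrable_continuous_interval continuous_intros f gc)
    also have "\<dots> \<le> integral {0..1} (\<lambda>y. \<epsilon> * \<bar>f y\<bar>)"
    proof (intro integral_le integrable_continuous_interval continuous_intros f gc)
      fix y :: real assume y: "y \<in> {0..1}"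
      have "f y * f y * sin (pi * y) - f y * sin (pi * y) * g (cos (pi * y)) =
          f y * sin (pi * y) * (\<phi> (cos (pi * y)) - g (cos (pi * y)))"
        using f\<phi>[OF y] by (simp add: algebra_simps)
      also have "\<dots> \<le> \<bar>f y\<bar> * \<bar>sin (pi * y)\<bar> * \<bar>\<phi> (cos (pi * y)) - g (cos (pi * y))\<bar>"
        by (simp only: abs_mult[symmetric] abs_ge_self)
      also have "\<dots> \<le> \<bar>f y\<bar> * 1 * \<epsilon>"
        using g(2)[of "cos (pi * y)"] by (intro mult_mono) auto
      finally show "f y * f y * sin (pi * y) - f y * sin (pi * y) * g (cos (pi * y)) \<le> \<epsilon> * \<bar>f y\<bar>"
        by (simp only: mult_1_right mult.commute[of \<epsilon>])
    qed
    finally show ?thesis by simp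
  qed
  have "((\<lambda>\<epsilon>. \<epsilon> * ?K) \<longlongrightarrow> 0 * ?K) (at_right 0)" by (intro tendsto_intros)
  then have "?I \<le> 0 * ?K"
    by (rule tendsto_lowerbound) (auto simp: eventually_at_right_field intro!: exI[of _ 1] bound)
  moreover have "0 \<le> ?I"
    using sin_pos by (intro integral_nonneg integrable_continuous_interval continuous_intros f) auto
  ultimately have "?I = 0" by simp
  moreover have "continuous_on {0..1} (\<lambda>y. f y * f y * sin (pi * y))" by (intro continuous_intros f)
  ultimately have "\<forall>y\<in>{0..1}. f y * f y * sin (pi * y) = 0"
    using sin_pos by (subst (asm) integral_eq_0_iff) auto
  moreover have "sin (pi * y) > 0" if "y \<in> {0<..<1}" for y :: real
    using that by (intro sin_gt_zero) auto
  \<comment> \<open>The weight vanishes at both ends, so only interior points are settled;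
    continuity of \<open>f\<close> handles the endpoints.\<close>
  ultimately have "f y = 0" if "y \<in> {0<..<1}" for y
    using that by (force simp: less_le)
  then show ?thesis
    using continuous_constant_on_closure[of "{0<..<1}" f 0 x] f x by simp
qed

section \<open>Heat flow in the sine basis\<close>

lemma summable_heat:
  assumes "0 < t"
  shows "summable (\<lambda>k. exp (- ((real (Suc k))\<^sup>2 * pi\<^sup>2 * t / 2)))"
proof (rule summable_comparison_test')
  \<comment> \<open>Since \<open>k \<le> (Suc k)^2\<close>, the geometric series with this ratio
    dominates.\<close>
  let ?q = "exp (- (pi\<^sup>2 * t / 2))"
  show "summable (\<lambda>k. ?q ^ k)" using assms by (intro summable_geometric) simp
  fix k :: nat
  have "real k * (pi\<^sup>2 * t / 2) \<le> (real (Suc k))\<^sup>2 * (pi\<^sup>2 * t / 2)"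
    using assms by (intro mult_right_mono) (auto simp: power2_eq_square algebra_simps)
  then show "norm (exp (- ((real (Suc k))\<^sup>2 * pi\<^sup>2 * t / 2))) \<le> ?q ^ k"
    by (simp add: exp_of_nat_mult[symmetric])
qed

text \<open>The deterministic term of the mild equation at positive times, and hence the mean of the
  solution.\<close>

definition heat_flow :: "(real \<Rightarrow> real) \<Rightarrow> real \<Rightarrow> real \<Rightarrow> real" where
  "heat_flow f t x = (LINT y:{0..1}|lborel. dirichlet_heat_kernel t x y * f y)"

text \<open>For fixed \<open>t > 0\<close> the exponential factors are summable and \<open>f\<close>
  is bounded, so the kernel series converges uniformly in \<open>y\<close> and can be integrated
  term by term.\<close>

lemma heat_flow_series:
  assumes f: "continuous_on {0..1} f" and t: "0 < t"
  shows "heat_flow f t x =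
      (\<Sum>k. 2 * exp (- ((real (Suc k))\<^sup>2 * pi\<^sup>2 * t / 2)) * sin (real (Suc k) * pi * x) * sine_coeff f (Suc k))"
proof -
  let ?a = "\<lambda>k. exp (- ((real (Suc k))\<^sup>2 * pi\<^sup>2 * t / 2))"
  let ?g = "\<lambda>k y. 2 * ?a k * sin (real (Suc k) * pi * x) * (f y * sin (real (Suc k) * pi * y))"
  obtain B where B: "\<And>y. y \<in> {0..1} \<Longrightarrow> \<bar>f y\<bar> \<le> B"
    using compact_continuous_image[OF f compact_Icc] unfolding real_norm_def[symmetric] by (metis bounded_iff compact_imp_bounded imageI)
  have g: "dirichlet_heat_kernel t x y * f y = (\<Sum>k. ?g k y)" for y
  proof -
    let ?s = "\<lambda>k. ?a k * sin (real (Suc k) * pi * x) * sin (real (Suc k) * pi * y)"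
    have "summable ?s"
    proof (rule summable_comparison_test'[OF summable_heat[OF t]])
      fix k :: nat
      have "\<bar>sin (real (Suc k) * pi * x)\<bar> * \<bar>sin (real (Suc k) * pi * y)\<bar> \<le> 1 * 1" by (intro mult_mono) auto
      then show "norm (?s k) \<le> ?a k" by (simp add: abs_mult mult.assoc del: of_nat_Suc)
    qed
    then have "(2 * f y) * (\<Sum>k. ?s k) = (\<Sum>k. (2 * f y) * ?s k)" by (rule suminf_mult[symmetric])
    then show ?thesis
      unfolding dirichlet_heat_kernel_def Let_def by (simp only: mult_ac)
  qed
  have bound: "\<bar>?g k y\<bar> \<le> 2 * B * ?a k" if y: "y \<in> {0..1}" for k y
  proof -
    have "\<bar>sin (real (Suc k) * pi * x)\<bar> * (\<bar>f y\<bar> * \<bar>sin (real (Suc k) * pi * y)\<bar>) \<le> 1 * (B * 1)"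
      using B[OF y] by (intro mult_mono) auto
    then have "2 * ?a k * (\<bar>sin (real (Suc k) * pi * x)\<bar> * (\<bar>f y\<bar> * \<bar>sin (real (Suc k) * pi * y)\<bar>)) \<le> 2 * ?a k * (1 * (B * 1))"
      by (intro mult_left_mono) auto
    then show ?thesis by (simp add: abs_mult mult_ac del: of_nat_Suc)
  qed
  have cont: "continuous_on {0..1} (?g k)" for k by (intro continuous_intros f)
  have sum: "summable (\<lambda>k. 2 * B * ?a k)" by (intro summable_mult summable_heat t)
  note s = sums_integral_continuous[of 0 1 ?g, OF cont bound sum]
  have "heat_flow f t x = (LINT y:{0..1}|lborel. (\<Sum>k. ?g k y))"
    unfolding heat_flow_def by (simp only: g)
  also have "\<dots> = integral {0..1} (\<lambda>y. \<Sum>k. ?g k y)"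
    using s(2) by (intro set_borel_integral_eq_integral borel_integrable_atLeastAtMost')
  also have "\<dots> = (\<Sum>k. integral {0..1} (?g k))" using s(1) by (rule sums_unique)
  also have "\<dots> = (\<Sum>k. 2 * ?a k * sin (real (Suc k) * pi * x) * sine_coeff f (Suc k))"
    by (simp only: integral_mult_right sine_coeff_def)
  finally show ?thesis .
qed

lemma sine_coeff_bounded:
  assumes f: "continuous_on {0..1} f"
  shows "\<bar>sine_coeff f n\<bar> \<le> integral {0..1} (\<lambda>y. \<bar>f y\<bar>)"
  unfolding sine_coeff_def real_norm_def[symmetric]
proof (rule integral_norm_bound_integral)
  fix y :: real
  show "norm (f y * sin (real n * pi * y)) \<le> norm (f y)" by (simp add: abs_mult mult_left_le)
qed (intro integrable_continuous_interval continuous_intros f)+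

text \<open>Orthogonality isolates one mode. The 2 of the kernel cancels the 1/2 from the squared
  sine, which leaves only the decay of the n-th eigenvalue.\<close>

lemma heat_flow_sine_coeff:
  assumes f: "continuous_on {0..1} f" and t: "0 < t" and n: "0 < n"
  shows "continuous_on {0..1} (heat_flow f t)"
    and "sine_coeff (heat_flow f t) n = exp (- ((real n)\<^sup>2 * pi\<^sup>2 * t / 2)) * sine_coeff f n"
proof -
  let ?a = "\<lambda>k. exp (- ((real (Suc k))\<^sup>2 * pi\<^sup>2 * t / 2))"
  let ?K = "integral {0..1} (\<lambda>y. \<bar>f y\<bar>)"
  have K: "0 \<le> ?K" by (rule order_trans[OF _ sine_coeff_bounded[OF f, of 0]]) simp
  let ?h = "\<lambda>k x. 2 * ?a k * sin (real (Suc k) * pi * x) * sine_coeff f (Suc k)"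
  have h: "heat_flow f t = (\<lambda>x. \<Sum>k. ?h k x)"
    using heat_flow_series[OF f t] by (rule ext)
  have bound: "\<bar>?h k x\<bar> \<le> 2 * ?K * ?a k" for k x
  proof -
    have "\<bar>sin (real (Suc k) * pi * x)\<bar> * \<bar>sine_coeff f (Suc k)\<bar> \<le> 1 * ?K"
      using K sine_coeff_bounded[OF f] by (intro mult_mono) auto
    then have "2 * ?a k * (\<bar>sin (real (Suc k) * pi * x)\<bar> * \<bar>sine_coeff f (Suc k)\<bar>) \<le> 2 * ?a k * (1 * ?K)"
      by (intro mult_left_mono) auto
    then show ?thesis by (simp add: abs_mult mult_ac del: of_nat_Suc)
  qed
  have sum: "summable (\<lambda>k. 2 * ?K * ?a k)" by (intro summable_mult summable_heat t)
  have "continuous_on {0..1} (?h k)" for k by (intro continuous_intros)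
  from sums_integral_continuous(2)[of 0 1 ?h, OF this bound sum]
  show "continuous_on {0..1} (heat_flow f t)" unfolding h .
  let ?g = "\<lambda>k x. ?h k x * sin (real n * pi * x)"
  have g: "heat_flow f t x * sin (real n * pi * x) = (\<Sum>k. ?g k x)" for x
  proof -
    have "summable (\<lambda>k. ?h k x)" using bound by (intro summable_comparison_test'[OF sum]) auto
    then show ?thesis unfolding h by (rule suminf_mult2)
  qed
  have gb: "\<bar>?g k x\<bar> \<le> 2 * ?K * ?a k" for k x
  proof -
    have "\<bar>?g k x\<bar> \<le> \<bar>?h k x\<bar>" unfolding abs_mult[of _ "sin (real n * pi * x)"] by (rule mult_left_le) auto
    then show ?thesis using bound[of k x] by (rule order_trans)
  qed
  have gc: "continuous_on {0..1} (?g k)" for k by (intro continuous_intros)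
  \<comment> \<open>Index \<open>k\<close> stands for frequency \<open>Suc k\<close>, so frequency
    \<open>n\<close> sits at \<open>k = n - 1\<close>.\<close>
  have int: "integral {0..1} (?g k) = (if k = n - 1 then ?a (n - 1) * sine_coeff f n else 0)" for k
  proof -
    have "?g k = (\<lambda>x. (2 * ?a k * sine_coeff f (Suc k)) * (sin (real (Suc k) * pi * x) * sin (real n * pi * x)))"
      by (simp add: fun_eq_iff)
    then have "integral {0..1} (?g k) = (2 * ?a k * sine_coeff f (Suc k)) * (if Suc k = n then 1 / 2 else 0)"
      using integral_sin_sin[of "Suc k" n] n by (simp only: integral_mult_right)
    then show ?thesis using n by auto
  qed
  have "(\<lambda>k. integral {0..1} (?g k)) sums integral {0..1} (\<lambda>x. \<Sum>k. ?g k x)"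
    using gc gb sum by (rule sums_integral_continuous(1))
  moreover have "(\<lambda>k. if k = n - 1 then ?a (n - 1) * sine_coeff f n else 0) sums (?a (n - 1) * sine_coeff f n)"
    by (rule sums_single)
  ultimately have "integral {0..1} (\<lambda>x. \<Sum>k. ?g k x) = ?a (n - 1) * sine_coeff f n"
    unfolding int by (rule sums_unique2)
  then show "sine_coeff (heat_flow f t) n = exp (- ((real n)\<^sup>2 * pi\<^sup>2 * t / 2)) * sine_coeff f n"
    using n unfolding sine_coeff_def[of "heat_flow f t"] g by simp
qed

section \<open>The Walsh integral has mean zero\<close>

lemma noise_domain_mono:
  assumes "A \<in> noise_domain" "B \<in> sets borel" "B \<subseteq> A"
  shows "B \<in> noise_domain"
proof -
  have "emeasure lborel B \<le> emeasure lborel A"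
    using assms by (intro emeasure_mono) (auto simp: noise_domain_def)
  then show ?thesis
    using assms unfolding noise_domain_def by (auto dest: le_less_trans)
qed

lemma noise_domain_Un:
  assumes "A \<in> noise_domain" "B \<in> noise_domain"
  shows "A \<union> B \<in> noise_domain"
proof -
  have "emeasure lborel (A \<union> B) \<le> emeasure lborel A + emeasure lborel B"
    using assms by (intro emeasure_subadditive) (auto simp: noise_domain_def)
  also have "\<dots> < \<infinity>"
    using assms by (simp add: noise_domain_def)
  finally show ?thesis using assms by (auto simp: noise_domain_def)
qed

lemma noise_domain_Union: "finite \<A> \<Longrightarrow> \<A> \<subseteq> noise_domain \<Longrightarrow> \<Union>\<A> \<in> noise_domain"
proof (induction rule: finite_induct)
  case empty
  show ?case by (simp add: noise_domain_def)
qed (simp add: noise_domain_Un)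

lemma emeasure_lborel_rectangle:
  assumes "a \<le> b" "A \<in> sets borel" "A \<subseteq> {0..1}"
  shows "emeasure lborel ({a..b} \<times> A :: (real \<times> real) set) \<le> ennreal (b - a)"
proof -
  have "emeasure lborel ({a..b} \<times> A) = emeasure lborel {a..b} * emeasure lborel A"
    using assms unfolding lborel_prod[symmetric] by (intro lborel.emeasure_pair_measure_Times) auto
  also have "\<dots> \<le> emeasure lborel {a..b} * emeasure lborel {0..1::real}"
    using assms by (intro mult_left_mono emeasure_mono) auto
  finally show ?thesis using assms by simp
qed

lemma borel_rectangle: "A \<in> sets borel \<Longrightarrow> B \<in> sets borel \<Longrightarrow> A \<times> B \<in> sets (borel :: (real \<times> real) measure)"
  unfolding borel_prod[symmetric] by (rule pair_measureI)

lemma rectangle_noise_domain: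
  assumes "0 \<le> a" "A \<in> sets borel" "A \<subseteq> {0..1}"
  shows "{a..b} \<times> A \<in> noise_domain" "{a<..b} \<times> A \<in> noise_domain"
proof -
  show *: "{a..b} \<times> A \<in> noise_domain"
  proof (cases "a \<le> b")
    case True
    have "emeasure lborel ({a..b} \<times> A) < \<infinity>"
      using emeasure_lborel_rectangle[OF True assms(2,3)] by (rule le_less_trans) simp
    moreover have "{a..b} \<times> A \<in> sets borel" using assms(2) by (rule borel_rectangle[rotated]) simp
    ultimately show ?thesis using assms(1,3) by (auto simp: noise_domain_def)
  qed (simp add: noise_domain_def)
  show "{a<..b} \<times> A \<in> noise_domain"
    using assms by (intro noise_domain_mono[OF *] borel_rectangle) auto
qed

lemma measure_rectangle_le:
  assumes "a \<le> b" "A \<in> sets borel" "A \<subseteq> {0..1}"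
  shows "measure lborel ({a<..b} \<times> A :: (real \<times> real) set) \<le> b - a"
proof -
  have "emeasure lborel ({a<..b} \<times> A) \<le> emeasure lborel ({a..b} \<times> A)"
    using assms by (intro emeasure_mono) (auto intro!: borel_rectangle)
  also have "\<dots> \<le> ennreal (b - a)" by (rule emeasure_lborel_rectangle[OF assms])
  finally show ?thesis using assms(1) by (simp add: measure_def enn2real_leI)
qed

text \<open>White noise is independent only over disjoint sets, so overlapping sets are cut into the
  atoms of the finite algebra they generate.\<close>

lemma disjoint_refinement:
  assumes "finite \<D>" "\<D> \<subseteq> noise_domain"
  obtains \<A> where "finite \<A>" "\<A> \<subseteq> noise_domain" "disjoint \<A>" "\<Union>\<A> \<subseteq> \<Union>\<D>"
    "\<And>D. D \<in> \<D> \<Longrightarrow> D = \<Union>{a\<in>\<A>. a \<subseteq> D}"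
proof -
  \<comment> \<open>An atom collects the points lying in exactly the members of a subfamily. The
    empty subfamily is left out below: its atom, the complement of the union, has infinite
    area.\<close>
  define atom where "atom = (\<lambda>\<T>. \<Inter>\<T> - \<Union>(\<D> - \<T>))"
  define \<A> where "\<A> = atom ` (Pow \<D> - {{}})"
  have fin: "finite \<A>" using assms(1) by (simp add: \<A>_def)
  have borel: "\<And>D. D \<in> \<D> \<Longrightarrow> D \<in> sets borel" using assms(2) by (auto simp: noise_domain_def)
  have sub: "a \<in> noise_domain" if a: "a \<in> \<A>" for a
  proof -
    obtain \<T> where "\<T> \<in> Pow \<D> - {{}}" and T: "a = atom \<T>" using a unfolding \<A>_def by (rule imageE)
    then obtain D where T: "\<T> \<subseteq> \<D>" "D \<in> \<T>" "a = atom \<T>" by auto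
    have "finite \<T>" using T(1) assms(1) by (rule finite_subset)
    then have "(\<Inter>D\<in>\<T>. D) \<in> sets borel"
      using T borel by (intro sets.finite_INT) auto
    moreover have "\<Union>(\<D> - \<T>) \<in> sets borel"
      using borel assms(1) by (intro sets.finite_Union) auto
    ultimately have "atom \<T> \<in> sets borel" by (simp add: atom_def sets.Diff)
    moreover have "atom \<T> \<subseteq> D" using T(2) by (auto simp: atom_def)
    moreover have "D \<in> noise_domain" using T(1,2) assms(2) by blast
    ultimately show ?thesis unfolding T(3) by (blast intro: noise_domain_mono)
  qed
  have eq: "atom \<T> = atom \<T>'"
    if T: "\<T> \<subseteq> \<D>" "\<T>' \<subseteq> \<D>" and x: "x \<in> atom \<T>" "x \<in> atom \<T>'" for x \<T> \<T>'
  proof -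
    have "D \<in> \<T> \<longleftrightarrow> D \<in> \<T>'" if D: "D \<in> \<D>" for D
      using D x unfolding atom_def by blast
    then have "\<T> = \<T>'" using T by blast
    then show ?thesis by simp
  qed
  have dis: "disjoint \<A>"
  proof (rule disjointI)
    fix a b assume ab: "a \<in> \<A>" "b \<in> \<A>" "a \<noteq> b"
    then obtain \<T> \<T>' where "\<T> \<subseteq> \<D>" "\<T>' \<subseteq> \<D>" "a = atom \<T>" "b = atom \<T>'"
      unfolding \<A>_def by blast
    then show "a \<inter> b = {}" using eq ab(3) by blast
  qed
  have un: "\<Union>\<A> \<subseteq> \<Union>\<D>" by (auto simp: \<A>_def atom_def)
  have "D \<subseteq> \<Union>{a\<in>\<A>. a \<subseteq> D}" if D: "D \<in> \<D>" for D
  proof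
    fix x assume x: "x \<in> D"
    let ?T = "{E\<in>\<D>. x \<in> E}"
    have "x \<in> atom ?T" unfolding atom_def using x by blast
    moreover have "atom ?T \<subseteq> D" unfolding atom_def using D x by blast
    moreover have "atom ?T \<in> \<A>" unfolding \<A>_def using D x by (intro imageI) blast
    ultimately show "x \<in> \<Union>{a\<in>\<A>. a \<subseteq> D}" by blast
  qed
  then have "\<And>D. D \<in> \<D> \<Longrightarrow> D = \<Union>{a\<in>\<A>. a \<subseteq> D}" by blast
  then show thesis using that[of \<A>] fin sub dis un by blast
qed

section \<open>Independence of past and future noise\<close>

locale noise_space = prob_space M for M :: "'w measure" +
  fixes W :: "(real \<times> real) set \<Rightarrow> 'w \<Rightarrow> real"
  assumes noise: "white_noise M W"
begin

text \<open>White noise gives independence for enumerated families; indexing by the sets themselves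
  makes it possible to split off one set from the others.\<close>

lemma indep_vars_reindex_image:
  assumes "inj_on f I" "indep_vars (\<lambda>i. N (f i)) (\<lambda>i. X (f i)) I"
  shows "indep_vars N X (f ` I)"
  unfolding indep_vars_def2
proof (intro conjI indep_setsI)
  show "\<forall>i\<in>f ` I. random_variable (N i) (X i)"
    using assms(2) by (auto simp: indep_vars_def2)
  then show "\<And>i. i \<in> f ` I \<Longrightarrow> {X i -` A \<inter> space M |A. A \<in> sets (N i)} \<subseteq> events"
    by (auto intro: measurable_sets)
  fix A J
  assume J: "J \<noteq> {}" "J \<subseteq> f ` I" "finite J"
    and A: "\<forall>j\<in>J. A j \<in> {X j -` A \<inter> space M |A. A \<in> sets (N j)}"
  obtain K where K: "K \<subseteq> I" "J = f ` K" using J(2) by (auto simp: subset_image_iff)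
  have inj: "inj_on f K" using assms(1) K(1) by (rule inj_on_subset)
  have "prob (\<Inter>k\<in>K. A (f k)) = (\<Prod>k\<in>K. prob (A (f k)))"
    using assms(2) J A K inj unfolding indep_vars_def2
    by (intro indep_setsD[where I = I]) (auto dest: finite_imageD)
  then show "prob (\<Inter>j\<in>J. A j) = (\<Prod>j\<in>J. prob (A j))"
    using K(2) inj by (simp add: prod.reindex)
qed

lemma noise_measurable: "A \<in> noise_domain \<Longrightarrow> W A \<in> borel_measurable M"
  using noise unfolding white_noise_def by blast

lemma noise_null: "A \<in> noise_domain \<Longrightarrow> measure lborel A = 0 \<Longrightarrow> AE \<omega> in M. W A \<omega> = 0"
  using noise unfolding white_noise_def by blast

lemma noise_Un:
  "A \<in> noise_domain \<Longrightarrow> B \<in> noise_domain \<Longrightarrow> A \<inter> B = {} \<Longrightarrow> AE \<omega> in M. W (A \<union> B) \<omega> = W A \<omega> + W B \<omega>"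
  using noise unfolding white_noise_def by blast

lemma noise_distributed:
  "A \<in> noise_domain \<Longrightarrow> measure lborel A > 0 \<Longrightarrow>
    distributed M lborel (W A) (\<lambda>x. ennreal (normal_density 0 (sqrt (measure lborel A)) x))"
  using noise unfolding white_noise_def by blast

lemma noise_Union:
  assumes "finite \<A>" "\<A> \<subseteq> noise_domain" "disjoint \<A>"
  shows "AE \<omega> in M. W (\<Union>\<A>) \<omega> = (\<Sum>a\<in>\<A>. W a \<omega>)"
  using assms
proof (induction rule: finite_induct)
  case empty
  show ?case using noise_null[of "{}"] by (simp add: noise_domain_def)
next
  case (insert a \<A>)
  have "AE \<omega> in M. W (a \<union> \<Union>\<A>) \<omega> = W a \<omega> + W (\<Union>\<A>) \<omega>"
    using insert by (intro noise_Un noise_domain_Union) (auto simp: disjoint_def)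
  moreover have "AE \<omega> in M. W (\<Union>\<A>) \<omega> = (\<Sum>a\<in>\<A>. W a \<omega>)"
    using insert by (intro insert.IH) (auto simp: disjoint_def)
  ultimately show ?case using insert by (auto elim: AE_mp)
qed

lemma noise_indep_vars:
  assumes "finite \<A>" "\<A> \<subseteq> noise_domain" "disjoint \<A>"
  shows "indep_vars (\<lambda>_. borel) W \<A>"
proof -
  obtain e where e: "bij_betw e {..<card \<A>} \<A>"
    using ex_bij_betw_nat_finite[OF assms(1)] by (auto simp: atLeast0LessThan)
  have "disjoint_family_on e {..<card \<A>}"
    using assms(3) e unfolding disjoint_family_on_def disjoint_def bij_betw_def
    by (metis image_eqI inj_on_eq_iff)
  moreover have "\<forall>i<card \<A>. e i \<in> noise_domain"
    using e assms(2) by (auto simp: bij_betw_def)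
  ultimately have *: "indep_vars (\<lambda>_. borel) (\<lambda>i. W (e i)) {..<card \<A>}"
    using noise by (auto simp: white_noise_def)
  show ?thesis
    using indep_vars_reindex_image[of e "{..<card \<A>}", OF _ *] e by (simp add: bij_betw_def)
qed

text \<open>Area 0 is the degenerate law without a density and is treated by almost sure equality
  with 0; otherwise the moments are those of the normal density.\<close>

lemma noise_moments:
  assumes "A \<in> noise_domain"
  shows "integrable M (W A)" "expectation (W A) = 0"
    "integrable M (\<lambda>\<omega>. (W A \<omega>)\<^sup>2)" "expectation (\<lambda>\<omega>. (W A \<omega>)\<^sup>2) = measure lborel A"
proof -
  have [measurable]: "W A \<in> borel_measurable M" by (rule noise_measurable[OF assms])
  have "integrable M (W A) \<and> expectation (W A) = 0 \<and> integrable M (\<lambda>\<omega>. (W A \<omega>)\<^sup>2) \<and>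
    expectation (\<lambda>\<omega>. (W A \<omega>)\<^sup>2) = measure lborel A"
  proof (cases "measure lborel A = 0")
    case True
    have ae: "AE \<omega> in M. W A \<omega> = 0" by (rule noise_null[OF assms True])
    have ae2: "AE \<omega> in M. (W A \<omega>)\<^sup>2 = 0" using ae by eventually_elim simp
    have "integrable M (W A)" using integrable_cong_AE[of "W A" M "\<lambda>_. 0"] ae by simp
    moreover have "expectation (W A) = 0" using integral_cong_AE[of "W A" M "\<lambda>_. 0"] ae by simp
    moreover have "integrable M (\<lambda>\<omega>. (W A \<omega>)\<^sup>2)" using integrable_cong_AE[of "\<lambda>\<omega>. (W A \<omega>)\<^sup>2" M "\<lambda>_. 0"] ae2 by simp
    moreover have "expectation (\<lambda>\<omega>. (W A \<omega>)\<^sup>2) = 0" using integral_cong_AE[of "\<lambda>\<omega>. (W A \<omega>)\<^sup>2" M "\<lambda>_. 0"] ae2 by simp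
    ultimately show ?thesis using True by simp
  next
    case False
    then have pos: "measure lborel A > 0" by (simp add: zero_less_measure_iff)
    let ?s = "sqrt (measure lborel A)"
    have s: "?s > 0" using pos by simp
    note D = noise_distributed[OF assms pos]
    have "integrable lborel (\<lambda>x. normal_density 0 ?s x * x)"
      using integrable_normal_moment[OF s, of 0 1] by simp
    then have "integrable M (W A)"
      using distributed_integrable[OF D, of "\<lambda>x. x"] by simp
    moreover have "integrable lborel (\<lambda>x. normal_density 0 ?s x * x\<^sup>2)"
      using integrable_normal_moment[OF s, of 0 2] by simp
    then have "integrable M (\<lambda>\<omega>. (W A \<omega>)\<^sup>2)"
      using distributed_integrable[OF D, of "\<lambda>x. x\<^sup>2"] by simp
    moreover have e: "expectation (W A) = 0" by (rule normal_distributed_expectation[OF s D])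
    moreover have "expectation (\<lambda>\<omega>. (W A \<omega>)\<^sup>2) = measure lborel A"
      using normal_distributed_variance[OF s D] e pos by simp
    ultimately show ?thesis by simp
  qed
  then show "integrable M (W A)" "expectation (W A) = 0"
    "integrable M (\<lambda>\<omega>. (W A \<omega>)\<^sup>2)" "expectation (\<lambda>\<omega>. (W A \<omega>)\<^sup>2) = measure lborel A" by auto
qed

text \<open>The sets in \<open>\<D>\<close> may overlap each other, but each \<open>W D\<close> is
  almost surely a sum over atoms, and the atoms together with \<open>C\<close> form a disjoint
  family.\<close>

lemma noise_indep_finite:
  assumes "finite \<D>" "\<D> \<subseteq> noise_domain" "C \<in> noise_domain" "C \<inter> \<Union>\<D> = {}" "C \<noteq> {}"
    and "B \<in> sets (PiM \<D> (\<lambda>_. borel))" "B' \<in> sets borel"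
  shows "prob ({\<omega>\<in>space M. (\<lambda>D\<in>\<D>. W D \<omega>) \<in> B} \<inter> (W C -` B' \<inter> space M)) =
         prob {\<omega>\<in>space M. (\<lambda>D\<in>\<D>. W D \<omega>) \<in> B} * prob (W C -` B' \<inter> space M)"
proof -
  obtain \<A> where \<A>: "finite \<A>" "\<A> \<subseteq> noise_domain" "disjoint \<A>" "\<Union>\<A> \<subseteq> \<Union>\<D>"
    "\<And>D. D \<in> \<D> \<Longrightarrow> D = \<Union>{a\<in>\<A>. a \<subseteq> D}"
    using disjoint_refinement[OF assms(1,2)] by blast
  \<comment> \<open>An atom may be empty; for nonempty \<open>C\<close> it cannot coincide with
    one.\<close>
  have C\<A>: "C \<notin> \<A>" using \<A>(4) assms(4,5) by blast
  have [measurable]: "W C \<in> borel_measurable M" by (rule noise_measurable[OF assms(3)])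
  have mD[measurable]: "\<And>D. D \<in> \<D> \<Longrightarrow> W D \<in> borel_measurable M" using assms(2) by (auto intro: noise_measurable)
  have mA[measurable]: "\<And>D. D \<in> \<A> \<Longrightarrow> W D \<in> borel_measurable M" using \<A>(2) by (auto intro: noise_measurable)
  note [measurable] = assms(6,7)
  define F where "F = (\<lambda>w :: (real \<times> real) set \<Rightarrow> real. \<lambda>D\<in>\<D>. \<Sum>a\<in>{a\<in>\<A>. a \<subseteq> D}. w a)"
  have F[measurable]: "F \<in> PiM \<A> (\<lambda>_. borel) \<rightarrow>\<^sub>M PiM \<D> (\<lambda>_. borel)"
    unfolding F_def by (rule measurable_restrict) (intro borel_measurable_sum measurable_component_singleton; simp)
  define V where "V = (\<lambda>\<omega>. \<lambda>a\<in>\<A>. W a \<omega>)"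
  have V[measurable]: "V \<in> M \<rightarrow>\<^sub>M PiM \<A> (\<lambda>_. borel)"
    unfolding V_def by (rule measurable_restrict) (rule mA)
  have U[measurable]: "(\<lambda>\<omega>. \<lambda>D\<in>\<D>. W D \<omega>) \<in> M \<rightarrow>\<^sub>M PiM \<D> (\<lambda>_. borel)"
    by (rule measurable_restrict) (rule mD)
  have "indep_vars (\<lambda>_. borel) W (insert C \<A>)"
  proof (rule noise_indep_vars)
    have "C \<inter> a = {}" if "a \<in> \<A>" for a using that \<A>(4) assms(4) by blast
    then show "disjoint (insert C \<A>)" using \<A>(3) unfolding disjoint_def by blast
  qed (use \<A> assms(3) in auto)
  then have "indep_var (PiM \<A> (\<lambda>_. borel)) V (PiM {C} (\<lambda>_. borel)) (\<lambda>\<omega>. restrict (\<lambda>i. W i \<omega>) {C})"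
    unfolding V_def by (rule indep_var_restrict) (use C\<A> in auto)
  then have ind: "indep_var (PiM \<D> (\<lambda>_. borel)) (F \<circ> V) (PiM {C} (\<lambda>_. borel)) (id \<circ> (\<lambda>\<omega>. restrict (\<lambda>i. W i \<omega>) {C}))"
    by (rule indep_var_compose[OF _ F]) (simp add: id_def)
  \<comment> \<open>Independence was obtained for tuples indexed by \<open>{C}\<close>, so the event
    on \<open>W C\<close> is rewritten as one on the single coordinate.\<close>
  let ?B = "(\<lambda>w. w C) -` B' \<inter> space (PiM {C} (\<lambda>_. borel :: real measure))"
  have B: "?B \<in> sets (PiM {C} (\<lambda>_. borel))"
    by (rule measurable_sets[OF _ assms(7)]) simp
  \<comment> \<open>Additivity fails on a null set that depends on \<open>D\<close>; as
    \<open>\<D>\<close> is finite, the union of these null sets is null.\<close>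
  have "AE \<omega> in M. \<forall>D\<in>\<D>. W D \<omega> = (\<Sum>a\<in>{a\<in>\<A>. a \<subseteq> D}. W a \<omega>)"
  proof (intro AE_finite_allI assms(1))
    fix D assume D: "D \<in> \<D>"
    have "AE \<omega> in M. W (\<Union>{a\<in>\<A>. a \<subseteq> D}) \<omega> = (\<Sum>a\<in>{a\<in>\<A>. a \<subseteq> D}. W a \<omega>)"
      using \<A> by (intro noise_Union) (auto simp: disjoint_def)
    then show "AE \<omega> in M. W D \<omega> = (\<Sum>a\<in>{a\<in>\<A>. a \<subseteq> D}. W a \<omega>)"
      using \<A>(5)[OF D] by simp
  qed
  then have ae: "AE \<omega> in M. (\<lambda>D\<in>\<D>. W D \<omega>) = (F \<circ> V) \<omega>"
    by eventually_elim (auto simp: F_def V_def fun_eq_iff intro!: sum.cong)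
  let ?E = "{\<omega>\<in>space M. (\<lambda>D\<in>\<D>. W D \<omega>) \<in> B}" and ?E' = "(F \<circ> V) -` B \<inter> space M"
  let ?C = "W C -` B' \<inter> space M"
  have m: "?E \<in> events" "?E' \<in> events" "?C \<in> events" by measurable
  have "prob (?E \<inter> ?C) = prob (?E' \<inter> ?C)"
    using m by (intro finite_measure_eq_AE) (use ae in \<open>auto elim!: eventually_mono\<close>)
  also have "\<dots> = prob ?E' * prob ?C"
  proof -
    let ?R = "id \<circ> (\<lambda>\<omega>. restrict (\<lambda>i. W i \<omega>) {C})"
    have R: "?R -` ?B \<inter> space M = ?C" by (auto simp: space_PiM)
    then have "(\<lambda>x. ((F \<circ> V) x, ?R x)) -` (B \<times> ?B) \<inter> space M = ?E' \<inter> ?C" by blast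
    then show ?thesis using indep_varD[OF ind assms(6) B] R by simp
  qed
  also have "prob ?E' = prob ?E"
    using m by (intro finite_measure_eq_AE) (use ae in \<open>auto elim!: eventually_mono\<close>)
  finally show ?thesis .
qed

lemma noise_algebra_generators:
  "{W ({0..s} \<times> A) -` B \<inter> space M | s A B.
      0 \<le> s \<and> s \<le> t \<and> A \<in> sets borel \<and> A \<subseteq> {0..1} \<and> B \<in> sets borel} \<union> null_sets M \<subseteq> events"
  by (auto intro!: measurable_sets[OF noise_measurable] rectangle_noise_domain)

lemma noise_algebra_events: "noise_algebra M W t \<subseteq> events"
  unfolding noise_algebra_def by (rule sets.sigma_sets_subset[OF noise_algebra_generators])

text \<open>The generating \<open>\<pi>\<close>-system \<open>P\<close> consists of the events that are almost surely determined by finitely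
  many values of the noise; allowing null sets makes it contain the augmentation.\<close>

lemma noise_algebra_indep:
  assumes "0 \<le> r" "C \<in> noise_domain" "C \<inter> {0..r} \<times> {0..1} = {}" "C \<noteq> {}"
  shows "indep_set (noise_algebra M W r) (sigma_sets (space M) {W C -` B \<inter> space M | B. B \<in> sets borel})"
proof -
  define P where "P = {E \<in> events. \<exists>\<D> B. finite \<D> \<and> \<D> \<subseteq> noise_domain \<and> \<Union>\<D> \<subseteq> {0..r} \<times> {0..1} \<and>
    B \<in> sets (PiM \<D> (\<lambda>_. borel)) \<and> (AE \<omega> in M. \<omega> \<in> E \<longleftrightarrow> (\<lambda>D\<in>\<D>. W D \<omega>) \<in> B)}"
  define Q where "Q = {W C -` B \<inter> space M | B. B \<in> sets (borel :: real measure)}"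
  have PE: "P \<subseteq> events" by (auto simp: P_def)
  have mC: "W C \<in> borel_measurable M" by (rule noise_measurable[OF assms(2)])
  have QE: "Q \<subseteq> events" using measurable_sets[OF mC] by (auto simp: Q_def)
  have tuple: "(\<lambda>\<omega>. \<lambda>D\<in>\<D>. W D \<omega>) \<in> M \<rightarrow>\<^sub>M PiM \<D> (\<lambda>_. borel)" if "\<D> \<subseteq> noise_domain" for \<D>
    using that by (intro measurable_restrict noise_measurable) auto
  have "indep_set P Q"
  proof (rule indep_setI[OF PE QE])
    fix E F assume E: "E \<in> P" and F: "F \<in> Q"
    obtain \<D> B where D: "finite \<D>" "\<D> \<subseteq> noise_domain" "\<Union>\<D> \<subseteq> {0..r} \<times> {0..1}"
      "B \<in> sets (PiM \<D> (\<lambda>_. borel))" "AE \<omega> in M. \<omega> \<in> E \<longleftrightarrow> (\<lambda>D\<in>\<D>. W D \<omega>) \<in> B"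
      using E by (auto simp: P_def)
    obtain B' where B': "F = W C -` B' \<inter> space M" "B' \<in> sets borel" using F by (auto simp: Q_def)
    let ?E = "{\<omega>\<in>space M. (\<lambda>D\<in>\<D>. W D \<omega>) \<in> B}"
    have mE: "?E \<in> events" using measurable_sets[OF tuple[OF D(2)] D(4)] by (simp add: vimage_def Int_def conj_commute)
    have disj: "C \<inter> \<Union>\<D> = {}" using D(3) assms(3) by blast
    have EE: "E \<in> events" "F \<in> events" using E F PE QE by auto
    have "prob (E \<inter> F) = prob (?E \<inter> F)"
      using mE EE D(5) by (intro finite_measure_eq_AE sets.Int) (auto elim!: eventually_mono)
    also have "\<dots> = prob ?E * prob F"
      unfolding B'(1) by (rule noise_indep_finite[OF D(1,2) assms(2) disj assms(4) D(4) B'(2)])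
    also have "prob ?E = prob E"
      using mE EE D(5) by (intro finite_measure_eq_AE) (auto elim!: eventually_mono)
    finally show "prob (E \<inter> F) = prob E * prob F" .
  qed
  moreover have "Int_stable P"
  proof (rule Int_stableI)
    fix E F assume E: "E \<in> P" and F: "F \<in> P"
    obtain \<D> B where D: "finite \<D>" "\<D> \<subseteq> noise_domain" "\<Union>\<D> \<subseteq> {0..r} \<times> {0..1}"
      "B \<in> sets (PiM \<D> (\<lambda>_. borel))" "AE \<omega> in M. \<omega> \<in> E \<longleftrightarrow> (\<lambda>D\<in>\<D>. W D \<omega>) \<in> B"
      using E by (auto simp: P_def)
    obtain \<D>' B' where D': "finite \<D>'" "\<D>' \<subseteq> noise_domain" "\<Union>\<D>' \<subseteq> {0..r} \<times> {0..1}"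
      "B' \<in> sets (PiM \<D>' (\<lambda>_. borel))" "AE \<omega> in M. \<omega> \<in> F \<longleftrightarrow> (\<lambda>D\<in>\<D>'. W D \<omega>) \<in> B'"
      using F by (auto simp: P_def)
    \<comment> \<open>Both events are read off the joint tuple over
      \<open>\<D> \<union> \<D>'\<close> by restricting it to each index set.\<close>
    let ?N = "PiM (\<D> \<union> \<D>') (\<lambda>_. borel :: real measure)"
    let ?B = "((\<lambda>w. restrict w \<D>) -` B \<inter> space ?N) \<inter> ((\<lambda>w. restrict w \<D>') -` B' \<inter> space ?N)"
    have B: "?B \<in> sets ?N"
      using D(4) D'(4) by (intro sets.Int measurable_sets[OF measurable_restrict_subset]) auto
    have "(\<lambda>D\<in>\<D>\<union>\<D>'. W D \<omega>) \<in> ?B \<longleftrightarrow> (\<lambda>D\<in>\<D>. W D \<omega>) \<in> B \<and> (\<lambda>D\<in>\<D>'. W D \<omega>) \<in> B'" for \<omega>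
      by (simp add: space_PiM Int_absorb1 Int_absorb2 restrict_restrict)
    note inB = this
    have "AE \<omega> in M. \<omega> \<in> E \<inter> F \<longleftrightarrow> (\<lambda>D\<in>\<D>\<union>\<D>'. W D \<omega>) \<in> ?B"
      using D(5) D'(5) unfolding inB by eventually_elim blast
    moreover have "E \<inter> F \<in> events" using E F PE by auto
    ultimately show "E \<inter> F \<in> P"
      unfolding P_def using D(1-3) D'(1-3) B
      by (intro CollectI conjI exI[of _ "\<D> \<union> \<D>'"] exI[of _ ?B]) auto
  qed
  moreover have "Int_stable Q"
  proof (rule Int_stableI)
    fix E F assume "E \<in> Q" "F \<in> Q"
    then obtain B B' where B: "E = W C -` B \<inter> space M" "B \<in> sets borel" "F = W C -` B' \<inter> space M" "B' \<in> sets borel"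
      by (auto simp: Q_def)
    then have "E \<inter> F = W C -` (B \<inter> B') \<inter> space M" "B \<inter> B' \<in> sets borel" by auto
    then show "E \<inter> F \<in> Q" unfolding Q_def by blast
  qed
  ultimately have ind: "indep_set (sigma_sets (space M) P) (sigma_sets (space M) Q)"
    by (rule indep_set_sigma_sets)
  have gen: "W D -` B \<inter> space M \<in> P" if D: "D \<in> noise_domain" "D \<subseteq> {0..r} \<times> {0..1}" "B \<in> sets borel" for D B
  proof -
    let ?B = "(\<lambda>w. w D) -` B \<inter> space (PiM {D} (\<lambda>_. borel :: real measure))"
    have "?B \<in> sets (PiM {D} (\<lambda>_. borel))" by (rule measurable_sets[OF _ D(3)]) simp
    moreover have "AE \<omega> in M. \<omega> \<in> W D -` B \<inter> space M \<longleftrightarrow> (\<lambda>E\<in>{D}. W E \<omega>) \<in> ?B"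
      by (rule AE_I2) (simp add: space_PiM)
    moreover have "W D -` B \<inter> space M \<in> events" using noise_measurable[OF D(1)] D(3) by (rule measurable_sets)
    ultimately show ?thesis unfolding P_def using D(1,2)
      by (intro CollectI conjI exI[of _ "{D}"] exI[of _ ?B]) auto
  qed
  have null: "N \<in> P" if N: "N \<in> null_sets M" for N
  proof -
    \<comment> \<open>A null set is almost surely avoided, so the empty family with the empty target
      set represents it.\<close>
    have "AE \<omega> in M. \<omega> \<in> N \<longleftrightarrow> (\<lambda>D\<in>{}. W D \<omega>) \<in> {}" using AE_not_in[OF N] by simp
    then show ?thesis unfolding P_def using N
      by (intro CollectI conjI exI[of _ "{}"]) auto
  qed
  have "noise_algebra M W r \<subseteq> sigma_sets (space M) P"
    unfolding noise_algebra_def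
  proof (rule sigma_sets_mono', safe)
    fix s and A B :: "real set" assume "0 \<le> s" "s \<le> r" "A \<in> sets borel" "A \<subseteq> {0..1}" "B \<in> sets borel"
    then show "W ({0..s} \<times> A) -` B \<inter> space M \<in> P"
      by (intro gen rectangle_noise_domain) auto
  qed (rule null)
  then show ?thesis
    using ind unfolding Q_def[symmetric] indep_sets2_eq by blast
qed

section \<open>Expectations against future noise and of the Walsh integral\<close>

lemma expectation_mult_noise:
  assumes X: "integrable M X" "\<And>B. B \<in> sets borel \<Longrightarrow> X -` B \<inter> space M \<in> noise_algebra M W r"
    and C: "0 \<le> r" "C \<in> noise_domain" "C \<inter> {0..r} \<times> {0..1} = {}"
  shows "expectation (\<lambda>\<omega>. X \<omega> * W C \<omega>) = 0"
proof (cases "C = {}")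
  case True
  have "AE \<omega> in M. W C \<omega> = 0" using noise_null[OF C(2)] True by simp
  then have "AE \<omega> in M. X \<omega> * W C \<omega> = 0" by eventually_elim simp
  then show ?thesis by (rule integral_eq_zero_AE)
next
  case False
  have XM: "X \<in> borel_measurable M" using X(1) by simp
  have ind: "indep_set (noise_algebra M W r) (sigma_sets (space M) {W C -` B \<inter> space M | B. B \<in> sets borel})"
    using C False by (rule noise_algebra_indep)
  have "sigma_sets (space M) {X -` B \<inter> space M | B. B \<in> sets borel} \<subseteq> noise_algebra M W r"
    unfolding noise_algebra_def by (rule sigma_sets_mono) (use X(2) in \<open>auto simp: noise_algebra_def\<close>)
  then have "indep_var borel X borel (W C)"
    using ind XM noise_measurable[OF C(2)] unfolding indep_var_eq indep_sets2_eq by blast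
  then have "expectation (\<lambda>\<omega>. X \<omega> * W C \<omega>) = expectation X * expectation (W C)"
    using X(1) noise_moments(1)[OF C(2)] by (rule indep_var_lebesgue_integral)
  then show ?thesis using noise_moments(2)[OF C(2)] by simp
qed

text \<open>The right-continuous filtration at \<open>t\<close> lies inside the noise algebra of
  every strictly later time, but not evidently inside that of \<open>t\<close>; hence
  \<open>t < r\<close>.\<close>

lemma noise_filtration_measurable:
  assumes "X \<in> borel_measurable (noise_filtration M W t)"
  shows "X \<in> borel_measurable M"
    and "t < r \<Longrightarrow> B \<in> sets borel \<Longrightarrow> X -` B \<inter> space M \<in> noise_algebra M W r"
proof -
  have Pow: "noise_algebra M W r \<subseteq> Pow (space M)" for r
    using noise_algebra_events sets.space_closed by blast
  \<comment> \<open>Any later time would do; the inclusion shows that the intersection consists of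
    subsets of the space, as \<open>sigma\<close> presupposes.\<close>
  have "(\<Inter>r\<in>{t<..}. noise_algebra M W r) \<subseteq> noise_algebra M W (t + 1)"
    by (rule INT_lower) simp
  with Pow[of "t + 1"] have Inter: "(\<Inter>r\<in>{t<..}. noise_algebra M W r) \<subseteq> Pow (space M)"
    by (rule order_trans[rotated])
  then have sp: "space (noise_filtration M W t) = space M"
    unfolding noise_filtration_def using space_measure_of[OF Inter] by simp
  have sub: "sets (noise_filtration M W t) \<subseteq> noise_algebra M W r" if "t < r" for r
  proof -
    have "sets (noise_filtration M W t) = sigma_sets (space M) (\<Inter>r\<in>{t<..}. noise_algebra M W r)"
      unfolding noise_filtration_def using sets_measure_of[OF Inter] by simp
    also have "\<dots> \<subseteq> sigma_sets (space M) (noise_algebra M W r)"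
      using that by (intro sigma_sets_mono') auto
    also have "\<dots> = noise_algebra M W r"
      unfolding noise_algebra_def by (rule sigma_sets_sigma_sets_eq) (use noise_algebra_generators sets.space_closed in blast)
    finally show ?thesis .
  qed
  have *: "X -` B \<inter> space M \<in> noise_algebra M W r" if "t < r" "B \<in> sets borel" for r B
    using measurable_sets[OF assms that(2)] sub[OF that(1)] sp by auto
  then show "t < r \<Longrightarrow> B \<in> sets borel \<Longrightarrow> X -` B \<inter> space M \<in> noise_algebra M W r" by blast
  show "X \<in> borel_measurable M"
    using *[of "t + 1"] noise_algebra_events by (intro measurableI) auto
qed

lemma square_expectation_le:
  fixes Y :: "'w \<Rightarrow> real"
  assumes "Y \<in> borel_measurable M" "integrable M (\<lambda>\<omega>. (Y \<omega>)\<^sup>2)"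
  shows "(expectation Y)\<^sup>2 \<le> expectation (\<lambda>\<omega>. (Y \<omega>)\<^sup>2)"
proof -
  have "integrable M Y" using assms by (rule square_integrable_imp_integrable)
  then show ?thesis using variance_eq[OF _ assms(2)] variance_positive[of Y] by simp
qed

text \<open>The filtration is right-continuous, so only the increments from \<open>r > a\<close> on are independent of
  \<open>X\<close>. The remaining \<open>{a<..r} \<times> A\<close> has variance at most \<open>r - a\<close>, and \<open>r \<rightarrow> a\<close>.\<close>

lemma expectation_noise_increment:
  assumes X: "X \<in> borel_measurable (noise_filtration M W a)" "\<And>\<omega>. \<omega> \<in> space M \<Longrightarrow> \<bar>X \<omega>\<bar> \<le> c"
    and ab: "0 \<le> a" "a \<le> b" and A: "A \<in> sets borel" "A \<subseteq> {0..1}"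
  shows "integrable M (\<lambda>\<omega>. X \<omega> * W ({a<..b} \<times> A) \<omega>)"
    and "expectation (\<lambda>\<omega>. X \<omega> * W ({a<..b} \<times> A) \<omega>) = 0"
proof -
  note [measurable] = noise_filtration_measurable(1)[OF X(1)]
  have c: "0 \<le> c" using not_empty X(2) by (meson abs_ge_zero order_trans subprob_not_empty ex_in_conv)
  have int: "integrable M (\<lambda>\<omega>. X \<omega> * W C \<omega>)" if C: "C \<in> noise_domain" for C
  proof (rule Bochner_Integration.integrable_bound)
    show "integrable M (\<lambda>\<omega>. c * W C \<omega>)" using noise_moments(1)[OF C] by simp
    show "(\<lambda>\<omega>. X \<omega> * W C \<omega>) \<in> borel_measurable M" using noise_measurable[OF C] by measurable
    show "AE \<omega> in M. norm (X \<omega> * W C \<omega>) \<le> norm (c * W C \<omega>)"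
      using X(2) c by (intro AE_I2) (simp add: abs_mult mult_right_mono)
  qed
  have dom: "{a<..b} \<times> A \<in> noise_domain" using ab(1) A by (rule rectangle_noise_domain(2))
  show "integrable M (\<lambda>\<omega>. X \<omega> * W ({a<..b} \<times> A) \<omega>)" by (rule int[OF dom])
  have intX: "integrable M X" by (rule integrable_const_bound[of _ c]) (use X(2) in auto)
  let ?e = "expectation (\<lambda>\<omega>. X \<omega> * W ({a<..b} \<times> A) \<omega>)"
  have bound: "?e\<^sup>2 \<le> c\<^sup>2 * (r - a)" if r: "a < r" "r \<le> b" for r
  proof -
    let ?D = "{a<..r} \<times> A" and ?C = "{r<..b} \<times> A"
    have D: "?D \<in> noise_domain" "?C \<in> noise_domain" using ab r A by (auto intro: rectangle_noise_domain)
    have un: "?D \<union> ?C = {a<..b} \<times> A" "?D \<inter> ?C = {}" using r by auto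
    have "AE \<omega> in M. X \<omega> * W ({a<..b} \<times> A) \<omega> = X \<omega> * W ?D \<omega> + X \<omega> * W ?C \<omega>"
      using noise_Un[OF D un(2)] unfolding un(1) by eventually_elim (simp add: algebra_simps)
    then have "?e = expectation (\<lambda>\<omega>. X \<omega> * W ?D \<omega> + X \<omega> * W ?C \<omega>)"
      using noise_measurable[OF D(1)] noise_measurable[OF D(2)] noise_measurable[OF dom]
      by (intro integral_cong_AE) auto
    also have "\<dots> = expectation (\<lambda>\<omega>. X \<omega> * W ?D \<omega>) + expectation (\<lambda>\<omega>. X \<omega> * W ?C \<omega>)"
      using D by (intro Bochner_Integration.integral_add int)
    \<comment> \<open>The rectangle \<open>?C\<close> begins after \<open>r\<close>, and since
      \<open>a < r\<close> the variable \<open>X\<close> is measurable with respect to the noise up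
      to \<open>r\<close>.\<close>
    also have "expectation (\<lambda>\<omega>. X \<omega> * W ?C \<omega>) = 0"
      using r ab by (intro expectation_mult_noise[OF intX _ _ D(2), of r] noise_filtration_measurable(2)[OF X(1)]) auto
    finally have e: "?e = expectation (\<lambda>\<omega>. X \<omega> * W ?D \<omega>)" by simp
    have le: "(X \<omega> * W ?D \<omega>)\<^sup>2 \<le> c\<^sup>2 * (W ?D \<omega>)\<^sup>2" if "\<omega> \<in> space M" for \<omega>
    proof -
      have "\<bar>X \<omega>\<bar>\<^sup>2 \<le> c\<^sup>2" using X(2)[OF that] by (intro power_mono) auto
      then show ?thesis by (simp add: power_mult_distrib mult_right_mono)
    qed
    have i: "integrable M (\<lambda>\<omega>. c\<^sup>2 * (W ?D \<omega>)\<^sup>2)" using noise_moments(3)[OF D(1)] by simp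
    have i2: "integrable M (\<lambda>\<omega>. (X \<omega> * W ?D \<omega>)\<^sup>2)"
      using noise_measurable[OF D(1)] le by (intro Bochner_Integration.integrable_bound[OF i]) auto
    have "?e\<^sup>2 \<le> expectation (\<lambda>\<omega>. (X \<omega> * W ?D \<omega>)\<^sup>2)"
      unfolding e using noise_measurable[OF D(1)] i2 by (intro square_expectation_le) auto
    also have "\<dots> \<le> expectation (\<lambda>\<omega>. c\<^sup>2 * (W ?D \<omega>)\<^sup>2)"
      using i i2 le by (intro integral_mono) auto
    also have "\<dots> = c\<^sup>2 * measure lborel ?D" using noise_moments(4)[OF D(1)] by simp
    also have "\<dots> \<le> c\<^sup>2 * (r - a)"
      using measure_rectangle_le[of a r A] r A by (intro mult_left_mono) auto
    finally show ?thesis .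
  qed
  show "?e = 0"
  \<comment> \<open>For \<open>a = b\<close> there is no \<open>r\<close> to let tend to
    \<open>a\<close>, but the rectangle is empty.\<close>
  proof (cases "a = b")
    case True
    then have "AE \<omega> in M. W ({a<..b} \<times> A) \<omega> = 0" by (intro noise_null[OF dom]) simp
    then have "AE \<omega> in M. X \<omega> * W ({a<..b} \<times> A) \<omega> = 0" by eventually_elim simp
    then show ?thesis by (rule integral_eq_zero_AE)
  next
    case False
    then have "a < b" using ab by simp
    then have "eventually (\<lambda>r. ?e\<^sup>2 \<le> c\<^sup>2 * (r - a)) (at_right a)"
      unfolding eventually_at_right[OF \<open>a < b\<close>] using bound by (intro exI[of _ b]) auto
    moreover have "((\<lambda>r. c\<^sup>2 * (r - a)) \<longlongrightarrow> c\<^sup>2 * (a - a)) (at_right a)" by (intro tendsto_intros)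
    ultimately have "?e\<^sup>2 \<le> c\<^sup>2 * (a - a)"
      by (intro tendsto_lowerbound) auto
    then show ?thesis by simp
  qed
qed

lemma simple_integral_mean_zero:
  assumes "simple_integrand M W \<phi>"
  shows "integrable M (simple_integral W \<phi>)" "expectation (simple_integral W \<phi>) = 0"
proof -
  have "integrable M (simple_integral W \<phi>) \<and> expectation (simple_integral W \<phi>) = 0"
    using assms
  proof (induction \<phi>)
    case Nil
    then show ?case by (simp add: simple_integral_def)
  next
    case (Cons e \<phi>)
    obtain X a b A where e: "e = (X, a, b, A)" by (cases e)
    have *: "0 \<le> a" "a \<le> b" "A \<in> sets borel" "A \<subseteq> {0..1}" "X \<in> borel_measurable (noise_filtration M W a)"
      "\<exists>c. \<forall>\<omega>\<in>space M. \<bar>X \<omega>\<bar> \<le> c" and s: "simple_integrand M W \<phi>"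
      using Cons.prems by (auto simp: simple_integrand_def e)
    then obtain c where c: "\<And>\<omega>. \<omega> \<in> space M \<Longrightarrow> \<bar>X \<omega>\<bar> \<le> c" by blast
    have "simple_integral W (e # \<phi>) = (\<lambda>\<omega>. X \<omega> * W ({a<..b} \<times> A) \<omega> + simple_integral W \<phi> \<omega>)"
      by (simp add: simple_integral_def e fun_eq_iff)
    then show ?case
      using Cons.IH[OF s] expectation_noise_increment[OF *(5) c *(1-4)] by simp
  qed
  then show "integrable M (simple_integral W \<phi>)" "expectation (simple_integral W \<phi>) = 0" by auto
qed

text \<open>The mean is continuous in L2: the squared difference of two means is at most the squared
  L2 distance, and the approximating simple integrals have mean 0.\<close>

lemma walsh_integral_mean_zero:
  assumes "has_walsh_integral M W f I"
  shows "integrable M I" "expectation I = 0"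
proof -
  obtain \<phi> where I: "I \<in> borel_measurable M" and \<phi>: "\<And>n::nat. simple_integrand M W (\<phi> n)"
    and lim: "(\<lambda>n. \<integral>\<^sup>+ \<omega>. ennreal ((simple_integral W (\<phi> n) \<omega> - I \<omega>)\<^sup>2) \<partial>M) \<longlonglongrightarrow> 0"
    using assms unfolding has_walsh_integral_def by blast
  note [measurable] = I borel_measurable_integrable[OF simple_integral_mean_zero(1)[OF \<phi>]]
  have *: "integrable M I \<and> (expectation I)\<^sup>2 \<le> \<epsilon>" if "\<epsilon> > 0" for \<epsilon> :: real
  proof -
    have "eventually (\<lambda>n. (\<integral>\<^sup>+ \<omega>. ennreal ((simple_integral W (\<phi> n) \<omega> - I \<omega>)\<^sup>2) \<partial>M) < ennreal \<epsilon>) sequentially"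
      using lim that by (intro order_tendstoD) auto
    then obtain n where n: "(\<integral>\<^sup>+ \<omega>. ennreal ((simple_integral W (\<phi> n) \<omega> - I \<omega>)\<^sup>2) \<partial>M) < ennreal \<epsilon>"
      by (auto simp: eventually_sequentially)
    let ?d = "\<lambda>\<omega>. simple_integral W (\<phi> n) \<omega> - I \<omega>"
    have d2: "integrable M (\<lambda>\<omega>. (?d \<omega>)\<^sup>2)"
      using n by (intro integrableI_bounded) (auto intro: less_trans)
    have d: "integrable M ?d" by (rule square_integrable_imp_integrable[OF _ d2]) measurable
    \<comment> \<open>So far \<open>I\<close> is only measurable; it is integrable as the simple
      integral minus the square-integrable difference.\<close>
    have "integrable M (\<lambda>\<omega>. simple_integral W (\<phi> n) \<omega> - ?d \<omega>)"
      using simple_integral_mean_zero(1)[OF \<phi>] d by (rule Bochner_Integration.integrable_diff)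
    then have I: "integrable M I" by simp
    have "expectation ?d = - expectation I"
      using simple_integral_mean_zero[OF \<phi>] I by (subst Bochner_Integration.integral_diff) auto
    then have "(expectation I)\<^sup>2 = (expectation ?d)\<^sup>2" by simp
    also have "\<dots> \<le> expectation (\<lambda>\<omega>. (?d \<omega>)\<^sup>2)" by (rule square_expectation_le[OF _ d2]) measurable
    also have "\<dots> \<le> \<epsilon>"
      using n nn_integral_eq_integral[OF d2] that by (simp add: ennreal_less_iff)
    finally show ?thesis using I by simp
  qed
  show "integrable M I" using *[of 1] by simp
  have "(expectation I)\<^sup>2 \<le> 0" by (rule field_le_epsilon) (use * in simp)
  then show "expectation I = 0" by simp
qed

lemma mild_solution_measurable:
  assumes "mild_solution M W u0 \<sigma> lam u" "0 \<le> t" "x \<in> {0..1}"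
  shows "u t x \<in> borel_measurable M"
  using assms unfolding mild_solution_def by (blast intro: noise_filtration_measurable(1))

text \<open>Expectation removes the stochastic term whatever its integrand, and the deterministic
  term remains.\<close>

lemma mild_solution_mean:
  assumes sol: "mild_solution M W u0 \<sigma> lam u" and "0 < t" "x \<in> {0..1}"
  shows "integrable M (u t x)"
    and "expectation (u t x) = (LINT y:{0..1}|lborel. dirichlet_heat_kernel t x y * u0 y)"
proof -
  have um: "u t x \<in> borel_measurable M" using assms by (intro mild_solution_measurable) auto
  obtain f I where I: "has_walsh_integral M W f I"
    and eq: "AE \<omega> in M. u t x \<omega> = (LINT y:{0..1}|lborel. dirichlet_heat_kernel t x y * u0 y) + I \<omega>"
    using assms unfolding mild_solution_def by blast
  let ?h = "LINT y:{0..1}|lborel. dirichlet_heat_kernel t x y * u0 y"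
  note i = walsh_integral_mean_zero[OF I]
  have "integrable M (u t x) \<longleftrightarrow> integrable M (\<lambda>\<omega>. ?h + I \<omega>)"
    using um i(1) eq by (intro integrable_cong_AE) auto
  then show "integrable M (u t x)" using i(1) by simp
  have "expectation (u t x) = expectation (\<lambda>\<omega>. ?h + I \<omega>)"
    using um i(1) eq by (intro integral_cong_AE) auto
  then show "expectation (u t x) = ?h" using i by (simp add: prob_space)
qed

end

section \<open>Spatial moments\<close>

abbreviation unit_lborel :: "real measure" where
  "unit_lborel \<equiv> restrict_space lborel {0..1}"

lemma finite_lborel_Icc: "finite_measure (restrict_space lborel {a..b::real})"
  by (rule finite_measureI) (simp add: space_restrict_space emeasure_restrict_space emeasure_lborel_Icc_eq)

text \<open>The approximations read \<open>X\<close> off a finite grid, where only measurability in \<open>\<omega>\<close> is needed.\<close>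

lemma continuous_jointly_measurable_version:
  fixes X :: "real \<Rightarrow> 'w \<Rightarrow> real"
  assumes X: "\<And>x. x \<in> {0..1} \<Longrightarrow> X x \<in> borel_measurable M"
    and cont: "AE \<omega> in M. continuous_on {0..1} (\<lambda>x. X x \<omega>)"
  obtains V where "(\<lambda>(x, \<omega>). V x \<omega>) \<in> borel_measurable (unit_lborel \<Otimes>\<^sub>M M)"
    and "AE \<omega> in M. \<forall>x. V x \<omega> = X x \<omega>"
proof -
  obtain N where N: "{\<omega>\<in>space M. \<not> continuous_on {0..1} (\<lambda>x. X x \<omega>)} \<subseteq> N" "N \<in> null_sets M"
    using cont by (auto elim!: AE_E)
  note [measurable] = null_setsD2[OF N(2)]
  \<comment> \<open>Setting \<open>X\<close> to 0 on a null set makes all paths continuous, and the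
    exceptional set is the same for all \<open>x\<close>.\<close>
  define V where "V = (\<lambda>x \<omega>. if \<omega> \<in> N then 0 else X x \<omega>)"
  \<comment> \<open>Grid points of mesh \<open>1 / Suc n\<close>, clamped to [0, 1] so that every
    integer index names a point at which \<open>X\<close> is measurable.\<close>
  define q where "q = (\<lambda>n (i::int). max 0 (min 1 (real_of_int i / real (Suc n))))"
  define r where "r = (\<lambda>n x. q n \<lfloor>real (Suc n) * x\<rfloor>)"
  have q01: "q n i \<in> {0..1}" for n i by (simp add: q_def)
  have rlim: "(\<lambda>n. r n x) \<longlonglongrightarrow> x" if x: "x \<in> {0..1}" for x
  proof (rule metric_LIMSEQ_I)
    fix e :: real assume "e > 0"
    then obtain n0 where n0: "1 / real (Suc n0) < e" using nat_approx_posE by blast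
    have "dist (r n x) x < e" if n: "n \<ge> n0" for n
    proof -
      let ?s = "real_of_int \<lfloor>real (Suc n) * x\<rfloor> / real (Suc n)"
      have "?s \<le> x" by (simp add: divide_le_eq mult.commute del: of_nat_Suc)
      moreover have "x - 1 / real (Suc n) < ?s"
      proof -
        have "x = real (Suc n) * x / real (Suc n)" by simp
        also have "\<dots> < (real_of_int \<lfloor>real (Suc n) * x\<rfloor> + 1) / real (Suc n)"
          using floor_correct[of "real (Suc n) * x"] by (intro divide_strict_right_mono) auto
        finally show ?thesis by (simp add: add_divide_distrib)
      qed
      moreover have "1 / real (Suc n) \<le> 1 / real (Suc n0)" using n by (simp add: frac_le)
      ultimately show ?thesis using x n0 by (auto simp: r_def q_def dist_real_def)
    qed
    then show "\<exists>n0. \<forall>n\<ge>n0. dist (r n x) x < e" by blast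
  qed
  have "(\<lambda>z. V (fst z) (snd z)) \<in> borel_measurable (unit_lborel \<Otimes>\<^sub>M M)"
  proof (rule borel_measurable_LIMSEQ_real)
    fix n
    have "(\<lambda>z. V (q n i) (snd z)) \<in> borel_measurable (unit_lborel \<Otimes>\<^sub>M M)" for i
    proof -
      have [measurable]: "X (q n i) \<in> borel_measurable M" using X q01 by blast
      show ?thesis unfolding V_def by measurable
    qed
    \<comment> \<open>The grid index is integer-valued, so the approximation is glued from countably
      many measurable pieces.\<close>
    moreover have "(\<lambda>z. \<lfloor>real (Suc n) * fst z\<rfloor>) \<in> unit_lborel \<Otimes>\<^sub>M M \<rightarrow>\<^sub>M count_space UNIV"
    proof -
      have "(\<lambda>x. \<lfloor>real (Suc n) * x\<rfloor>) \<in> unit_lborel \<rightarrow>\<^sub>M count_space UNIV"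
        by (rule measurable_restrict_space1) measurable
      then show ?thesis by (rule measurable_compose[OF measurable_fst])
    qed
    ultimately show "(\<lambda>z. V (r n (fst z)) (snd z)) \<in> borel_measurable (unit_lborel \<Otimes>\<^sub>M M)"
      unfolding r_def by (rule measurable_compose_countable)
  next
    fix z assume z: "z \<in> space (unit_lborel \<Otimes>\<^sub>M M)"
    obtain x \<omega> where z_eq: "z = (x, \<omega>)" by (cases z)
    have x: "x \<in> {0..1}" and \<omega>: "\<omega> \<in> space M" using z by (auto simp: z_eq space_pair_measure space_restrict_space)
    show "(\<lambda>n. V (r n (fst z)) (snd z)) \<longlonglongrightarrow> V (fst z) (snd z)"
    proof (cases "\<omega> \<in> N")
      case False
      then have "continuous_on {0..1} (\<lambda>x. X x \<omega>)" using N(1) \<omega> by blast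
      then have "(\<lambda>n. X (r n x) \<omega>) \<longlonglongrightarrow> X x \<omega>"
        using rlim[OF x] x q01 by (intro continuous_on_tendsto_compose[where s = "{0..1}" and f = "\<lambda>x. X x \<omega>"]) (auto simp: r_def)
      then show ?thesis using False by (simp add: V_def z_eq)
    qed (simp add: V_def z_eq)
  qed
  then have "(\<lambda>(x, \<omega>). V x \<omega>) \<in> borel_measurable (unit_lborel \<Otimes>\<^sub>M M)" by (simp add: case_prod_beta')
  moreover have "AE \<omega> in M. \<forall>x. V x \<omega> = X x \<omega>"
    using AE_not_in[OF N(2)] by eventually_elim (simp add: V_def)
  ultimately show thesis by (rule that)
qed

text \<open>Above the level \<open>c\<close> the factor \<open>(a / c) powr (p - 1)\<close> is at
  least 1; below it \<open>c\<close> suffices. This converts lower bounds on first moments into ones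
  on p-th moments.\<close>

lemma Young_split:
  fixes a c :: real
  assumes "0 \<le> a" "0 < c" "1 \<le> p"
  shows "a \<le> c + c powr (1 - p) * a powr p"
proof (cases "a \<le> c")
  case True
  then show ?thesis by (simp add: add_increasing2)
next
  case False
  then have "c powr (p - 1) \<le> a powr (p - 1)" using assms by (intro powr_mono2) auto
  then have "c powr (1 - p) * (c powr (p - 1) * a) \<le> c powr (1 - p) * (a powr (p - 1) * a)"
    using assms by (intro mult_left_mono mult_right_mono) auto
  moreover have "a powr (p - 1) * a = a powr p"
    using False assms by (simp add: powr_diff)
  moreover have "c powr (1 - p) * c powr (p - 1) = 1"
    using assms by (simp add: powr_add[symmetric])
  ultimately have "a \<le> c powr (1 - p) * a powr p" by (simp add: mult.assoc[symmetric])
  then show ?thesis using assms by simp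
qed

section \<open>Moment and energy bounds for mild solutions\<close>

context noise_space
begin

lemma mild_solution_continuous:
  assumes "mild_solution M W u0 \<sigma> lam u" "0 < t"
  shows "AE \<omega> in M. continuous_on {0..1} (\<lambda>x. u t x \<omega>)"
proof -
  have "AE \<omega> in M. continuous_on ({0..} \<times> {0..1} - {(0, 0), (0, 1)}) (\<lambda>(t, x). u t x \<omega>)"
    using assms(1) unfolding mild_solution_def by blast
  then show ?thesis
  proof eventually_elim
    case (elim \<omega>)
    have "continuous_on {0..1} (\<lambda>x. (\<lambda>(t, x). u t x \<omega>) (t, x))"
      using assms(2) by (intro continuous_on_compose2[OF elim] continuous_intros) auto
    then show ?case by simp
  qed
qed

text \<open>A jointly measurable version agrees with \<open>u t\<close> at all \<open>x\<close> for
  almost every sample, so it changes neither iterated integral.\<close>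

lemma mild_solution_moment_Fubini:
  assumes sol: "mild_solution M W u0 \<sigma> lam u" and t: "0 < t"
  shows "(\<lambda>x. moment_at M u p x t) \<in> borel_measurable unit_lborel"
    and "(\<integral>\<^sup>+ \<omega>. (\<integral>\<^sup>+ x. ennreal (\<bar>u t x \<omega>\<bar> powr p) \<partial>unit_lborel) \<partial>M) =
      (\<integral>\<^sup>+ x. moment_at M u p x t \<partial>unit_lborel)"
proof -
  note M_sigma_finite = sigma_finite_measure_axioms
  interpret U: finite_measure unit_lborel by (rule finite_lborel_Icc)
  interpret pair_sigma_finite unit_lborel M ..
  have um: "u t x \<in> borel_measurable M" if "x \<in> {0..1}" for x
    using mild_solution_measurable[OF sol _ that] t by simp
  obtain V where V: "(\<lambda>(x, \<omega>). V x \<omega>) \<in> borel_measurable (unit_lborel \<Otimes>\<^sub>M M)"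
    and eq: "AE \<omega> in M. \<forall>x. V x \<omega> = u t x \<omega>"
    using continuous_jointly_measurable_version[OF um mild_solution_continuous[OF sol t]] by blast
  have Vp: "(\<lambda>(x, \<omega>). ennreal (\<bar>V x \<omega>\<bar> powr p)) \<in> borel_measurable (unit_lborel \<Otimes>\<^sub>M M)"
    using V unfolding case_prod_beta' by measurable
  have m: "moment_at M u p x t = (\<integral>\<^sup>+ \<omega>. ennreal (\<bar>V x \<omega>\<bar> powr p) \<partial>M)" for x
    unfolding moment_at_def by (rule nn_integral_cong_AE) (use eq in \<open>auto elim!: eventually_mono\<close>)
  show "(\<lambda>x. moment_at M u p x t) \<in> borel_measurable unit_lborel"
    unfolding m
    using sigma_finite_measure.borel_measurable_nn_integral_fst[OF M_sigma_finite Vp] by simp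
  have "(\<integral>\<^sup>+ \<omega>. (\<integral>\<^sup>+ x. ennreal (\<bar>u t x \<omega>\<bar> powr p) \<partial>unit_lborel) \<partial>M) =
      (\<integral>\<^sup>+ \<omega>. (\<integral>\<^sup>+ x. ennreal (\<bar>V x \<omega>\<bar> powr p) \<partial>unit_lborel) \<partial>M)"
    by (rule nn_integral_cong_AE) (use eq in \<open>auto elim!: eventually_mono\<close>)
  also have "\<dots> = (\<integral>\<^sup>+ x. moment_at M u p x t \<partial>unit_lborel)"
    unfolding m using Fubini'[OF Vp] by simp
  finally show "(\<integral>\<^sup>+ \<omega>. (\<integral>\<^sup>+ x. ennreal (\<bar>u t x \<omega>\<bar> powr p) \<partial>unit_lborel) \<partial>M) =
      (\<integral>\<^sup>+ x. moment_at M u p x t \<partial>unit_lborel)" .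
qed

lemma Lp_norm_epow:
  assumes "0 < p"
  shows "epow (Lp_norm p f) p = (\<integral>\<^sup>+ x. ennreal (\<bar>f x\<bar> powr p) \<partial>unit_lborel)"
  unfolding Lp_norm_def using assms by (simp add: epow_epow_inverse nn_integral_restrict_space)

lemma mild_solution_energy:
  assumes sol: "mild_solution M W u0 \<sigma> lam u" and t: "0 < t" and p: "0 < p"
  shows "energy M u p t = epow (\<integral>\<^sup>+ x. moment_at M u p x t \<partial>unit_lborel) (1 / p)"
  unfolding energy_def Lp_norm_epow[OF p] mild_solution_moment_Fubini(2)[OF sol t] ..

text \<open>On an interval of length 1 the p-norm is at most the essential supremum, path by
  path.\<close>

lemma mild_solution_energy_le_sup:
  assumes sol: "mild_solution M W u0 \<sigma> lam u" and t: "0 < t" and p: "0 < p"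
  shows "energy M u p t \<le> epow (moment_sup M u p t) (1 / p)"
proof -
  have "(\<integral>\<^sup>+ x. ennreal (\<bar>f x\<bar> powr p) \<partial>unit_lborel) \<le> epow (Linfty_norm f) p" for f
  proof -
    have "(\<integral>\<^sup>+ x. ennreal (\<bar>f x\<bar> powr p) \<partial>unit_lborel) \<le> (\<integral>\<^sup>+ x. epow (Linfty_norm f) p \<partial>unit_lborel)"
    proof (rule nn_integral_mono_AE)
      show "AE x in unit_lborel. ennreal (\<bar>f x\<bar> powr p) \<le> epow (Linfty_norm f) p"
        using esssup_AE[of "\<lambda>x. ennreal \<bar>f x\<bar>" unit_lborel]
      proof eventually_elim
        case (elim x)
        then show ?case
          using epow_mono[of p "ennreal \<bar>f x\<bar>" "Linfty_norm f"] p
          by (simp add: epow_ennreal Linfty_norm_def)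
      qed
    qed
    then show ?thesis by (simp add: space_restrict_space emeasure_restrict_space)
  qed
  then show ?thesis
    unfolding energy_def moment_sup_def Lp_norm_epow[OF p] using p
    by (intro epow_mono nn_integral_mono) auto
qed

lemma mild_solution_heat_flow_le:
  assumes sol: "mild_solution M W u0 \<sigma> lam u" and t: "0 < t" and x: "x \<in> {0..1}"
  shows "ennreal \<bar>heat_flow u0 t x\<bar> \<le> moment_at M u 1 x t"
proof -
  note mean = mild_solution_mean[OF sol t x]
  have "ennreal \<bar>heat_flow u0 t x\<bar> = ennreal (norm (expectation (u t x)))"
    by (simp add: heat_flow_def mean(2))
  also have "\<dots> \<le> (\<integral>\<^sup>+ \<omega>. ennreal (norm (u t x \<omega>)) \<partial>M)"
    using mean(1) by (rule integral_norm_bound_ennreal)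
  finally show ?thesis by (simp add: moment_at_def)
qed

lemma mild_solution_energy_ge:
  assumes sol: "mild_solution M W u0 \<sigma> lam u" and u0: "continuous_on {0..1} u0"
    and t: "0 < t" and p: "1 \<le> p" and n: "0 < n" "sine_coeff u0 n \<noteq> 0"
  shows "ennreal (\<bar>sine_coeff u0 n\<bar> / 2 * exp (- ((real n)\<^sup>2 * pi\<^sup>2 / 2 * t))) \<le> energy M u p t"
proof -
  let ?h = "heat_flow u0 t" and ?S = "\<integral>\<^sup>+ x. moment_at M u p x t \<partial>unit_lborel"
  \<comment> \<open>\<open>c\<close> is half the modulus of the n-th sine coefficient of the heat
    flow, so \<open>2 * c\<close> bounds its L1 norm from below. Splitting at level \<open>c\<close>
    spends one half; the other half remains for the p-th moments.\<close>
  define c where "c = \<bar>sine_coeff u0 n\<bar> / 2 * exp (- ((real n)\<^sup>2 * pi\<^sup>2 / 2 * t))"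
  have c: "c > 0" using n by (simp add: c_def)
  note h = heat_flow_sine_coeff[OF u0 t n(1)]
  have habs: "continuous_on {0..1} (\<lambda>x. \<bar>?h x\<bar>)" by (intro continuous_intros h(1))
  have meas: "(\<lambda>x. moment_at M u p x t) \<in> borel_measurable unit_lborel"
    by (rule mild_solution_moment_Fubini(1)[OF sol t])
  have "2 * c = \<bar>sine_coeff ?h n\<bar>"
    unfolding h(2) c_def by (simp add: abs_mult)
  also have "\<dots> \<le> integral {0..1} (\<lambda>x. \<bar>?h x\<bar>)" by (rule sine_coeff_bounded[OF h(1)])
  also have "\<dots> = (LINT x:{0..1}|lborel. \<bar>?h x\<bar>)"
    by (intro set_borel_integral_eq_integral(2)[symmetric] borel_integrable_atLeastAtMost' habs)
  finally have "ennreal (2 * c) \<le> ennreal (LINT x:{0..1}|lborel. \<bar>?h x\<bar>)" by (rule ennreal_leI)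
  also have "\<dots> = (\<integral>\<^sup>+ x. ennreal (indicator {0..1} x *\<^sub>R \<bar>?h x\<bar>) \<partial>lborel)"
    using borel_integrable_atLeastAtMost'[OF habs] unfolding set_integrable_def set_lebesgue_integral_def
    by (intro nn_integral_eq_integral[symmetric]) auto
  also have "\<dots> = (\<integral>\<^sup>+ x. ennreal \<bar>?h x\<bar> \<partial>unit_lborel)"
    by (subst nn_integral_restrict_space) (auto intro!: nn_integral_cong split: split_indicator)
  also have "\<dots> \<le> (\<integral>\<^sup>+ x. ennreal c + ennreal (c powr (1 - p)) * moment_at M u p x t \<partial>unit_lborel)"
  proof (rule nn_integral_mono)
    fix x assume "x \<in> space unit_lborel"
    then have x: "x \<in> {0..1}" by (simp add: space_restrict_space)
    have [measurable]: "u t x \<in> borel_measurable M" using mild_solution_measurable[OF sol _ x] t by simp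
    have "ennreal \<bar>?h x\<bar> \<le> (\<integral>\<^sup>+ \<omega>. ennreal (\<bar>u t x \<omega>\<bar> powr 1) \<partial>M)"
      using mild_solution_heat_flow_le[OF sol t x] by (simp add: moment_at_def)
    also have "\<dots> \<le> (\<integral>\<^sup>+ \<omega>. ennreal c + ennreal (c powr (1 - p)) * ennreal (\<bar>u t x \<omega>\<bar> powr p) \<partial>M)"
      using Young_split[OF _ c p] c
      by (intro nn_integral_mono) (simp add: ennreal_plus[symmetric] ennreal_mult[symmetric] ennreal_leI del: ennreal_plus)
    also have "\<dots> = ennreal c + ennreal (c powr (1 - p)) * moment_at M u p x t"
      by (simp add: nn_integral_add nn_integral_cmult moment_at_def emeasure_space_1)
    finally show "ennreal \<bar>?h x\<bar> \<le> ennreal c + ennreal (c powr (1 - p)) * moment_at M u p x t" .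
  qed
  also have "\<dots> = ennreal c + ennreal (c powr (1 - p)) * ?S"
    using meas by (simp add: nn_integral_add nn_integral_cmult space_restrict_space emeasure_restrict_space)
  finally have *: "ennreal (2 * c) \<le> ennreal c + ennreal (c powr (1 - p)) * ?S" .
  \<comment> \<open>Cancelling one \<open>c\<close> leaves
    \<open>c \<le> c powr (1 - p) * ?S\<close>, which is rescaled by \<open>c powr (p - 1)\<close>;
    if \<open>?S\<close> is infinite nothing remains to show.\<close>
  have "ennreal (c powr p) \<le> ?S"
  proof (cases ?S rule: ennreal_cases)
    case (real s)
    have "2 * c \<le> c + c powr (1 - p) * s"
      using * c real by (simp add: ennreal_plus[symmetric] ennreal_mult[symmetric] del: ennreal_plus)
    then have "c powr (p - 1) * c \<le> c powr (p - 1) * (c powr (1 - p) * s)"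
      by (intro mult_left_mono) auto
    moreover have "c powr (p - 1) * c = c powr p" using c by (simp add: powr_diff)
    moreover have "c powr (p - 1) * c powr (1 - p) = 1" using c by (simp add: powr_add[symmetric])
    ultimately have "c powr p \<le> s" by (simp add: mult.assoc[symmetric])
    then show ?thesis using real by (simp add: ennreal_leI)
  qed simp
  then have "epow (ennreal (c powr p)) (1 / p) \<le> epow ?S (1 / p)" using p by (intro epow_mono) auto
  moreover have "epow (ennreal (c powr p)) (1 / p) = ennreal c"
    using epow_inverse_epow[of p "ennreal c"] p c by (simp add: epow_ennreal)
  ultimately show ?thesis
    using mild_solution_energy[OF sol t] p by (simp add: c_def)
qed

text \<open>Restricting the spatial integral to \<open>{a..b}\<close> only lowers it, and the p-th
  root turns the rate \<open>r\<close> into \<open>r / p\<close>.\<close>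

lemma mild_solution_energy_liminf_pos:
  assumes sol: "mild_solution M W u0 \<sigma> lam u" and p: "0 < p" and ab: "0 \<le> a" "a < b" "b \<le> 1"
    and pos: "\<And>x. x \<in> {a..b} \<Longrightarrow> 0 < liminf_rate (moment_at M u p x)"
  shows "0 < liminf_rate (energy M u p)"
proof -
  let ?N = "restrict_space lborel {a..b}"
  have meas: "(\<lambda>x. moment_at M u p x t) \<in> borel_measurable ?N" if "0 < t" for t
  proof -
    have "(\<lambda>x. moment_at M u p x t) \<in> borel_measurable (restrict_space unit_lborel {a..b})"
      by (rule measurable_restrict_space1[OF mild_solution_moment_Fubini(1)[OF sol that]])
    moreover have "restrict_space unit_lborel {a..b} = ?N"
      using ab by (subst restrict_restrict_space) (auto intro!: arg_cong[where f = "restrict_space lborel"])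
    ultimately show ?thesis by simp
  qed
  have "0 < liminf_rate (\<lambda>t. \<integral>\<^sup>+ x. moment_at M u p x t \<partial>?N)"
  proof (rule liminf_rate_integral_pos)
    show "finite_measure ?N" by (rule finite_lborel_Icc)
    show "emeasure ?N (space ?N) \<noteq> 0" using ab by (simp add: space_restrict_space emeasure_restrict_space)
  qed (use meas pos in \<open>auto simp: space_restrict_space\<close>)
  then obtain r where r: "r > 0"
    "eventually (\<lambda>t. ennreal (exp (r * t)) \<le> (\<integral>\<^sup>+ x. moment_at M u p x t \<partial>?N)) at_top"
    unfolding liminf_rate_pos_iff by blast
  have "eventually (\<lambda>t. ennreal (exp (r / p * t)) \<le> energy M u p t) at_top"
    using r(2) eventually_gt_at_top[of 0]
  proof eventually_elim
    case (elim t)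
    have "(\<integral>\<^sup>+ x. moment_at M u p x t \<partial>?N) \<le> (\<integral>\<^sup>+ x. moment_at M u p x t \<partial>unit_lborel)"
      using ab by (simp add: nn_integral_restrict_space) (auto intro!: nn_integral_mono split: split_indicator)
    with elim(1) have "ennreal (exp (r * t)) \<le> (\<integral>\<^sup>+ x. moment_at M u p x t \<partial>unit_lborel)" by (rule order_trans)
    then have "epow (ennreal (exp (r * t))) (1 / p) \<le> energy M u p t"
      unfolding mild_solution_energy[OF sol elim(2) p] using p by (intro epow_mono) auto
    moreover have "epow (ennreal (exp (r * t))) (1 / p) = ennreal (exp (r / p * t))"
      by (simp add: epow_ennreal powr_def)
    ultimately show ?case by simp
  qed
  then show ?thesis unfolding liminf_rate_pos_iff using r(1) p by (intro exI[of _ "r / p"]) simp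
qed

lemma mild_solution_energy_limsup_le:
  assumes sol: "mild_solution M W u0 \<sigma> lam u" and p: "0 < p"
  shows "limsup_rate (energy M u p) \<le> ereal (1 / p) * limsup_rate (moment_sup M u p)"
proof -
  have "limsup_rate (energy M u p) \<le> limsup_rate (\<lambda>t. epow (moment_sup M u p t) (1 / p))"
    using mild_solution_energy_le_sup[OF sol _ p] by (rule limsup_rate_mono)
  also have "\<dots> = ereal (1 / p) * limsup_rate (moment_sup M u p)"
    using p by (intro limsup_rate_epow) simp
  finally show ?thesis .
qed

end

theorem corollary1p5:
  fixes M :: "'w measure"
    and W :: "(real \<times> real) set \<Rightarrow> 'w \<Rightarrow> real"
    and u0 \<sigma> :: "real \<Rightarrow> real"
    and u :: "real \<Rightarrow> real \<Rightarrow> real \<Rightarrow> 'w \<Rightarrow> real"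
    and p \<gamma> K\<^sub>U K\<^sub>L lam\<^sub>L lam\<^sub>U :: real
  assumes "prob_space M"
    and "white_noise M W"
    and "p \<ge> 2"
    and "0 < \<gamma>" and "\<gamma> < 1 / 4"
    and A1: "continuous_on {0..1} u0" "measure lborel (supp u0 \<inter> {\<gamma>..1 - \<gamma>}) > 0"
    and A2: "\<sigma> 0 = 0" "K\<^sub>U > 0" "\<forall>a b. \<bar>\<sigma> a - \<sigma> b\<bar> \<le> K\<^sub>U * \<bar>a - b\<bar>"
    and A3: "K\<^sub>L > 0" "\<forall>a. K\<^sub>L * \<bar>a\<bar> \<le> \<bar>\<sigma> a\<bar>"
    and sol: "\<forall>lam>0. mild_solution M W u0 \<sigma> lam (u lam)"
    and "0 < lam\<^sub>L" and "lam\<^sub>L < lam\<^sub>U"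
    and i: "\<forall>lam\<in>{0<..<lam\<^sub>L}. \<forall>x\<in>{\<gamma>..1 - \<gamma>}.
        -\<infinity> < limsup_rate (moment_at M (u lam) p x) \<and>
        limsup_rate (moment_at M (u lam) p x) \<le> limsup_rate (moment_sup M (u lam) p) \<and>
        limsup_rate (moment_sup M (u lam) p) < 0"
    and ii: "\<forall>lam\<in>{lam\<^sub>U<..}. \<forall>x\<in>{\<gamma>..1 - \<gamma>}.
        0 < liminf_rate (moment_at M (u lam) p x) \<and>
        liminf_rate (moment_at M (u lam) p x) \<le> limsup_rate (moment_sup M (u lam) p) \<and>
        limsup_rate (moment_sup M (u lam) p) < \<infinity>"
  shows "(\<forall>lam. 0 < lam \<and> lam < lam\<^sub>L \<longrightarrow>
            -\<infinity> < limsup_rate (energy M (u lam) p) \<and> limsup_rate (energy M (u lam) p) < 0) \<and>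
         (\<forall>lam. lam\<^sub>U < lam \<longrightarrow>
            0 < liminf_rate (energy M (u lam) p) \<and> liminf_rate (energy M (u lam) p) < \<infinity>)"
proof (intro conjI[of "\<forall>lam. _ lam"] allI impI)
  interpret noise_space M W
    using assms(1,2) by (simp add: noise_space_def noise_space_axioms_def)
  \<comment> \<open>The bounds on \<open>moment_sup\<close> are independent of \<open>x\<close> but
    stated under a quantifier over \<open>x\<close>; \<open>\<gamma>\<close> serves as the
    point.\<close>
  have \<gamma>: "\<gamma> \<in> {\<gamma>..1 - \<gamma>}" using \<open>\<gamma> < 1 / 4\<close> by simp
  have p: "0 < p" "1 \<le> p" using \<open>p \<ge> 2\<close> by auto
  fix lam
  {
    assume lam: "0 < lam \<and> lam < lam\<^sub>L"
    have s: "mild_solution M W u0 \<sigma> lam (u lam)" using sol lam by simp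
    \<comment> \<open>A support of positive measure is nonempty, and it is the closure of the
      nonzero set, so \<open>u0\<close> has a nonzero value and with it a nonzero sine
      coefficient.\<close>
    have "supp u0 \<noteq> {}" using A1(2) by auto
    then obtain x where "x \<in> {0..1}" "u0 x \<noteq> 0" unfolding supp_def by (auto simp: closure_eq_empty)
    then obtain n where n: "0 < n" "sine_coeff u0 n \<noteq> 0" using sine_coeff_complete[OF A1(1)] by blast
    have "ereal (- ((real n)\<^sup>2 * pi\<^sup>2 / 2)) \<le> limsup_rate (energy M (u lam) p)"
      using n mild_solution_energy_ge[OF s A1(1) _ p(2) n]
      by (intro limsup_rate_ge_exponential[of "\<bar>sine_coeff u0 n\<bar> / 2"]) auto
    then have "-\<infinity> < limsup_rate (energy M (u lam) p)" by (rule less_le_trans[rotated]) simp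
    moreover have "limsup_rate (moment_sup M (u lam) p) < 0" using i lam \<gamma> by (meson greaterThanLessThan_iff)
    then have "ereal (1 / p) * limsup_rate (moment_sup M (u lam) p) < 0"
      using p by (cases "limsup_rate (moment_sup M (u lam) p)") (auto simp: mult_pos_neg divide_less_0_iff)
    then have "limsup_rate (energy M (u lam) p) < 0"
      using mild_solution_energy_limsup_le[OF s p(1)] by (rule le_less_trans[rotated])
    ultimately show "-\<infinity> < limsup_rate (energy M (u lam) p) \<and> limsup_rate (energy M (u lam) p) < 0" ..
  next
    assume lam: "lam\<^sub>U < lam"
    have s: "mild_solution M W u0 \<sigma> lam (u lam)" using sol lam \<open>0 < lam\<^sub>L\<close> \<open>lam\<^sub>L < lam\<^sub>U\<close> by simp
    \<comment> \<open>The pointwise rates are used on the whole of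
      \<open>{\<gamma>..1 - \<gamma>}\<close>, which has positive length because
      \<open>\<gamma> < 1 / 4\<close>.\<close>
    have "0 < liminf_rate (energy M (u lam) p)"
      by (rule mild_solution_energy_liminf_pos[OF s p(1), of \<gamma> "1 - \<gamma>"])
         (use ii lam \<open>0 < \<gamma>\<close> \<open>\<gamma> < 1 / 4\<close> in auto)
    moreover have "limsup_rate (moment_sup M (u lam) p) < \<infinity>" using ii lam \<gamma> by (meson greaterThan_iff)
    then have "ereal (1 / p) * limsup_rate (moment_sup M (u lam) p) < \<infinity>"
      using p by (cases "limsup_rate (moment_sup M (u lam) p)") auto
    then have "liminf_rate (energy M (u lam) p) < \<infinity>"
      using mild_solution_energy_limsup_le[OF s p(1)] liminf_rate_le_limsup_rate
      by (meson le_less_trans order_trans)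
    ultimately show "0 < liminf_rate (energy M (u lam) p) \<and> liminf_rate (energy M (u lam) p) < \<infinity>" ..
  }
qed

end
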